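(* Let $f_1,\dots,f_k$ be orientation-preserving homeomorphisms of the circle $\mathbb{S}^1$. Assume that the iterated function system generated by these maps is forward and backward minimal. Let $\mathbb{P}$ be a probability on $\Sigma_k^+=\{1,\dots,k\}^{\mathbb{N}}$ for which there is $0<p\le 1/k$ such that $\mathbb{P}(\omega_n=i \mid \omega_{n-1},\dots,\omega_1)\ge p$ for every $i\in\{1,\dots,k\}$ and every $n\in\mathbb{N}$. Then there exists $\Omega\subset\Sigma_k^+$ with $\mathbb{P}(\Omega)=1$ such that $$\mathbb{S}^1=\overline{\mathcal{O}^+_\omega(x)}\quad\text{for every } x\in\mathbb{S}^1 \text{ and every } \omega\in\Omega.$$ In particular, $\Omega$ contains all the sequences with dense orbit under the Bernoulli shift map; and if there exists a homeomorphism in $\mathrm{IFS}(f_1,\dots,f_k)$ which is not conjugate to a rotation, then the periodic points of $\mathrm{IFS}(f_1,\dots,f_k)$ are dense in $\mathbb{S}^1$.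
   Context: For maps $f_1,\dots,f_k$ of a compact metric space $X$, $\mathrm{IFS}(f_1,\dots,f_k)$ denotes the semigroup generated by $f_1,\dots,f_k$ under composition. The orbit of $x\in X$ is the set $\{h(x): h\in \mathrm{IFS}(f_1,\dots,f_k)\}$, and the IFS is minimal if every orbit is dense in $X$. For homeomorphisms $f_1,\dots,f_k$, the IFS is forward and backward minimal if both $\mathrm{IFS}(f_1,\dots,f_k)$ and $\mathrm{IFS}(f_1^{-1},\dots,f_k^{-1})$ are minimal. For $\omega=\omega_1\omega_2\dots\in\Sigma_k^+=\{1,\dots,k\}^{\mathbb{N}}$ (with the product topology and Borel $\sigma$-algebra) and $n\in\mathbb{N}$, set $f_\omega^n=f_{\omega_n}\circ\dots\circ f_{\omega_1}$, and let $\mathcal{O}^+_\omega(x)=\{f^n_\omega(x): n\in\mathbb{N}\}$ be the fiberwise orbit of $x$. The Bernoulli shift map on $\Sigma_k^+$ is $\omega_1\omega_2\omega_3\dots\mapsto\omega_2\omega_3\dots$. A point $q$ is a periodic point for $\mathrm{IFS}(f_1,\dots,f_k)$ if there is $h\in\mathrm{IFS}(f_1,\dots,f_k)$ with $h(q)=q$. "Conjugate to a rotation" means topologically conjugate to a rigid rotation of $\mathbb{S}^1$. *)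

theory Defs
  imports "HOL-Probability.Probability"
begin

abbreviation circle :: "complex set" where
  "circle \<equiv> sphere 0 1"

text \<open>A homeomorphism of the circle preserves orientation iff it has an increasing lift
  through the covering \<open>t \<mapsto> exp (2 \<pi> i t)\<close>. Maps of the circle are total functions
  on the complex plane whose values off the circle are irrelevant.\<close>

definition orientation_preserving_homeo :: "(complex \<Rightarrow> complex) \<Rightarrow> bool" where
  "orientation_preserving_homeo f \<longleftrightarrow>
     (\<exists>g. homeomorphism circle circle f g) \<and>
     (\<exists>F :: real \<Rightarrow> real. continuous_on UNIV F \<and> strict_mono F \<and>
        (\<forall>t. F (t + 1) = F t + 1) \<and>
        (\<forall>t. f (cis (2 * pi * t)) = cis (2 * pi * F t)))"

definition conjugate_to_rotation :: "(complex \<Rightarrow> complex) \<Rightarrow> bool" where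
  "conjugate_to_rotation h \<longleftrightarrow>
     (\<exists>\<theta> \<phi> \<psi>. homeomorphism circle circle \<phi> \<psi> \<and>
        (\<forall>z\<in>circle. \<phi> (h z) = cis \<theta> * \<phi> z))"

inductive_set IFS :: "nat \<Rightarrow> (nat \<Rightarrow> 'a \<Rightarrow> 'a) \<Rightarrow> ('a \<Rightarrow> 'a) set"
  for k :: nat and f :: "nat \<Rightarrow> 'a \<Rightarrow> 'a" where
  generator: "i \<in> {1..k} \<Longrightarrow> f i \<in> IFS k f"
| composition: "g \<in> IFS k f \<Longrightarrow> h \<in> IFS k f \<Longrightarrow> g \<circ> h \<in> IFS k f"

definition IFS_orbit :: "nat \<Rightarrow> (nat \<Rightarrow> 'a \<Rightarrow> 'a) \<Rightarrow> 'a \<Rightarrow> 'a set" where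
  "IFS_orbit k f x = {h x | h. h \<in> IFS k f}"

definition IFS_minimal :: "'a::metric_space set \<Rightarrow> nat \<Rightarrow> (nat \<Rightarrow> 'a \<Rightarrow> 'a) \<Rightarrow> bool" where
  "IFS_minimal X k f \<longleftrightarrow> (\<forall>x\<in>X. closure (IFS_orbit k f x) = X)"

definition forward_backward_minimal ::
    "'a::metric_space set \<Rightarrow> nat \<Rightarrow> (nat \<Rightarrow> 'a \<Rightarrow> 'a) \<Rightarrow> bool" where
  "forward_backward_minimal X k f \<longleftrightarrow>
     IFS_minimal X k f \<and> IFS_minimal X k (\<lambda>i. inv_into X (f i))"

definition IFS_periodic_points :: "'a set \<Rightarrow> nat \<Rightarrow> (nat \<Rightarrow> 'a \<Rightarrow> 'a) \<Rightarrow> 'a set" where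
  "IFS_periodic_points X k f = {q \<in> X. \<exists>h\<in>IFS k f. h q = q}"

text \<open>Sequences are indexed from zero: \<open>\<omega> n\<close> is the symbol \<open>\<omega>\<^sub>n\<^sub>+\<^sub>1\<close>. The topology on
  sequences is the product of the discrete topologies.\<close>

definition symbol_seqs :: "nat \<Rightarrow> (nat \<Rightarrow> nat) set" where
  "symbol_seqs k = {\<omega>. \<forall>n. \<omega> n \<in> {1..k}}"

definition shift :: "(nat \<Rightarrow> nat) \<Rightarrow> nat \<Rightarrow> nat" where
  "shift \<omega> = (\<lambda>n. \<omega> (Suc n))"

definition shift_dense_orbit :: "nat \<Rightarrow> (nat \<Rightarrow> nat) \<Rightarrow> bool" where
  "shift_dense_orbit k \<omega> \<longleftrightarrow> closure {(shift ^^ n) \<omega> | n. True} = symbol_seqs k"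

primrec fiber_iterate :: "(nat \<Rightarrow> 'a \<Rightarrow> 'a) \<Rightarrow> (nat \<Rightarrow> nat) \<Rightarrow> nat \<Rightarrow> 'a \<Rightarrow> 'a" where
  "fiber_iterate f \<omega> 0 = id"
| "fiber_iterate f \<omega> (Suc n) = f (\<omega> n) \<circ> fiber_iterate f \<omega> n"

definition fiber_orbit :: "(nat \<Rightarrow> 'a \<Rightarrow> 'a) \<Rightarrow> (nat \<Rightarrow> nat) \<Rightarrow> 'a \<Rightarrow> 'a set" where
  "fiber_orbit f \<omega> x = {fiber_iterate f \<omega> n x | n. n \<ge> 1}"

text \<open>The conditioning variables take finitely many values, so the condition on the conditional
  probability given the past is stated for each past \<open>a 0, \<dots>, a (n - 1)\<close> of positive
  probability; \<open>cond_prob\<close> is zero by convention on null events.\<close>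

definition transition_prob_ge :: "nat \<Rightarrow> (nat \<Rightarrow> nat) measure \<Rightarrow> real \<Rightarrow> bool" where
  "transition_prob_ge k P p \<longleftrightarrow>
     (\<forall>i\<in>{1..k}. \<forall>n. \<forall>a\<in>symbol_seqs k.
        \<P>(\<omega> in P. \<forall>j<n. \<omega> j = a j) > 0 \<longrightarrow>
        \<P>(\<omega> in P. \<omega> n = i \<bar> \<forall>j<n. \<omega> j = a j) \<ge> p)"

end

theory Submission imports Defs begin

text \<open>Call a word \<open>w\<close> universal for an open set \<open>W\<close> if the orbit along \<open>w\<close> of every point of the
circle enters \<open>W\<close> at some time. If every open \<open>W\<close> has a universal word, then a sequence that
contains all finite words (a \<^emph>\<open>disjunctive\<close> sequence) has dense fibre orbits from all starting
points simultaneously: wherever the orbit is when the universal word begins, it visits \<open>W\<close>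
before the word ends. Sequences with dense shift orbit are disjunctive, and so is almost every
sequence, because each letter has conditional probability at least \<open>p\<close> whatever the past was.
The density of fibre orbits thus rests on the lemma \<open>universal_word\<close>.

Let \<open>U\<close> be an arc in \<open>W\<close>, and suppose given a mass \<open>\<mu>\<close> on the subsets of the circle for which
the average of \<open>\<mu> (f i ` A)\<close> over \<open>i\<close> is at most \<open>\<mu> A\<close>; a stationary measure for the random walk
of the inverse maps would do. The points that survive a word \<open>w\<close>, that is, do not enter \<open>U\<close> after
the start, occupy at the end of \<open>w\<close> a finite union of arcs. A point \<open>x\<close> lies in this union iff the backward walk from
\<open>x\<close>, read along the reversed word, avoids \<open>U\<close>. By backward minimality a long backward walk avoids
\<open>U\<close> with small probability, uniformly in \<open>x\<close>, so that some word leaves survivors of mass less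
than any given \<open>\<delta>\<close> (\<open>avoiding_small_mean\<close>). The remaining arcs are then led into \<open>U\<close> one after
the other. By forward minimality a random word takes a given point to the middle part of \<open>U\<close>
with a probability bounded below, and as \<open>\<mu>\<close> is a supermartingale along random words, this can
be achieved while the total mass of the arcs stays below \<open>\<delta>\<close> (\<open>word_steers_point\<close>). If \<open>\<delta>\<close>
is at most the mass of each of the two gaps between the middle part and the ends of \<open>U\<close>, an arc that
meets the middle part and has mass less than \<open>\<delta>\<close> lies in \<open>U\<close> (\<open>light_arcs_swallowed\<close>).

In the role of \<open>\<mu>\<close> a superadditive functional is enough, and it can be written down at once: the
supremum over \<open>n\<close> of the infimum over starting points \<open>x\<close> of the probability that the lazy
backward walk from \<open>x\<close> is in \<open>A\<close> at time \<open>n\<close>. It is defined for all sets, and superadditivity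
gives both the supermartingale property and the estimate for the survivors.

For periodic points, suppose that along some words the images of a fixed nondegenerate arc become
arbitrarily short. Any open arc contains a small arc \<open>N\<close> that a word takes into the given one;
another word makes the image very short, and a third brings it back into \<open>N\<close>: a Lebesgue number
tells how short is short enough, wherever the image lies. The composition maps \<open>N\<close> into itself, so it has a
fixed point there (\<open>periodic_points_dense_if_arc_shrinks\<close>). Such an arc exists when some \<open>h\<close> in
the semigroup is not conjugate to a rotation, unless a power of \<open>h\<close> is the identity and all
points are periodic anyway: if a power of \<open>h\<close> has a fixed point and is not the identity, an arc
between a moved point and its image shrinks under iteration, and if no power has a fixed point,
Poincare's semiconjugacy to a rotation is continuous and is either a conjugacy or constant on an
arc, whose images are then pairwise disjoint (\<open>conjugate_or_shrinks_arc\<close>).\<close>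

section \<open>Words and minimality\<close>

lemma fold_in_closed:
  assumes "\<And>i x. i \<in> {1..k} \<Longrightarrow> x \<in> X \<Longrightarrow> f i x \<in> X" "s \<in> lists {1..k}" "x \<in> X"
  shows "fold f s x \<in> X"
  using assms(2,3) by (induction s arbitrary: x) (auto simp: assms(1))

lemma continuous_on_fold:
  assumes cont: "\<And>i. i \<in> {1..k} \<Longrightarrow> continuous_on X (f i)"
    and closed: "\<And>i x. i \<in> {1..k} \<Longrightarrow> x \<in> X \<Longrightarrow> f i x \<in> X"
    and "s \<in> lists {1..k}"
  shows "continuous_on X (fold f s)"
  using assms(3)
proof (induction s)
  case Nil then show ?case by (simp add: id_def)
next
  case (Cons i s)
  have "continuous_on X (fold f s \<circ> f i)"
  proof (rule continuous_on_compose)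
    show "continuous_on X (f i)" using cont Cons by simp
    show "continuous_on (f i ` X) (fold f s)"
      using Cons closed by (auto intro: continuous_on_subset)
  qed
  then show ?case by simp
qed

text \<open>The letters of a word are applied from left to right, so \<open>fold f v\<close> is the map of the word \<open>v\<close>
and concatenation of words reverses the order of composition.\<close>

lemma IFS_eq_words: "IFS k f = {fold f v | v. v \<in> lists {1..k} \<and> v \<noteq> []}"
proof (intro equalityI subsetI)
  fix h assume "h \<in> IFS k f"
  then show "h \<in> {fold f v | v. v \<in> lists {1..k} \<and> v \<noteq> []}"
  proof induction
    case (generator i)
    then have "f i = fold f [i] \<and> [i] \<in> lists {1..k} \<and> [i] \<noteq> []" by auto
    then show ?case by blast
  next
    case (composition g h)
    then obtain v w where "g = fold f v" "v \<in> lists {1..k}" "v \<noteq> []"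
      "h = fold f w" "w \<in> lists {1..k}" "w \<noteq> []" by blast
    then have "g \<circ> h = fold f (w @ v) \<and> w @ v \<in> lists {1..k} \<and> w @ v \<noteq> []" by simp
    then show ?case by blast
  qed
next
  fix h assume "h \<in> {fold f v | v. v \<in> lists {1..k} \<and> v \<noteq> []}"
  then obtain v where v: "h = fold f v" "v \<in> lists {1..k}" "v \<noteq> []" by blast
  have "fold f v \<in> IFS k f" using v(2,3)
  proof (induction v)
    case (Cons i v)
    then have i: "f i \<in> IFS k f" by (auto intro: IFS.generator)
    show ?case
    proof (cases "v = []")
      case True then show ?thesis using i by simp
    next
      case False
      then have "fold f v \<circ> f i \<in> IFS k f" using IFS.composition[OF Cons.IH i] Cons.prems by simp
      then show ?thesis by (simp add: o_def)
    qed
  qed simp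
  then show "h \<in> IFS k f" using v by simp
qed

lemma IFS_minimal_word:
  assumes "IFS_minimal X k f" "x \<in> X" "open V" "V \<inter> X \<noteq> {}"
  shows "\<exists>s\<in>lists {1..k}. s \<noteq> [] \<and> fold f s x \<in> V"
proof -
  obtain z where z: "z \<in> V" "z \<in> X" using assms(4) by blast
  then have "z \<in> closure (IFS_orbit k f x)" using assms(1,2) unfolding IFS_minimal_def by simp
  then obtain y where "y \<in> IFS_orbit k f x" "y \<in> V"
    using assms(3) z(1) closure_iff_nhds_not_empty by (metis disjoint_iff subset_refl)
  then show ?thesis unfolding IFS_orbit_def IFS_eq_words by blast
qed

text \<open>Compactness makes the hitting time bounded: the preimages of \<open>V\<close> under the words form an open
cover of \<open>X\<close>, and finitely many of them suffice. A bound on the length of the word is a lower bound on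
the probability that a random word reaches \<open>V\<close>.\<close>

lemma uniform_hitting_time:
  assumes "compact X"
    and cont: "\<And>i. i \<in> {1..k} \<Longrightarrow> continuous_on X (f i)"
    and closed: "\<And>i x. i \<in> {1..k} \<Longrightarrow> x \<in> X \<Longrightarrow> f i x \<in> X"
    and min: "IFS_minimal X k f" and V: "open V" "V \<inter> X \<noteq> {}"
  shows "\<exists>n. \<forall>x\<in>X. \<exists>s\<in>lists {1..k}. length s \<le> n \<and> fold f s x \<in> V"
proof -
  have "\<exists>A. open A \<and> A \<inter> X = fold f s -` V \<inter> X" if "s \<in> lists {1..k}" for s
    using continuous_on_fold[of k X f s] cont closed that V(1)
    unfolding continuous_on_open_invariant by blast
  then obtain A where A: "\<And>s. s \<in> lists {1..k} \<Longrightarrow> open (A s) \<and> A s \<inter> X = fold f s -` V \<inter> X"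
    by metis
  have "X \<subseteq> (\<Union>s\<in>lists {1..k}. A s)"
  proof
    fix x assume x: "x \<in> X"
    obtain s where "s \<in> lists {1..k}" "fold f s x \<in> V" using IFS_minimal_word[OF min x V] by blast
    then show "x \<in> (\<Union>s\<in>lists {1..k}. A s)" using A[of s] x by blast
  qed
  then obtain W where W: "W \<subseteq> lists {1..k}" "finite W" "X \<subseteq> (\<Union>s\<in>W. A s)"
    using compactE_image[OF assms(1), of "lists {1..k}" A] A by metis
  show ?thesis
  proof (intro exI ballI)
    fix x assume x: "x \<in> X"
    then obtain s where s: "s \<in> W" "x \<in> A s" using W(3) by blast
    then have "fold f s x \<in> V" using A[of s] W(1) x by blast
    moreover have "length s \<le> Max (length ` W)" using s(1) W(2) by simp
    ultimately show "\<exists>s\<in>lists {1..k}. length s \<le> Max (length ` W) \<and> fold f s x \<in> V"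
      using s W(1) by blast
  qed
qed

section \<open>The lower mean of a lazy random walk\<close>

text \<open>The walk stays put with probability one half. Hence the points that it can occupy after \<open>n\<close>
steps include all those that it could occupy earlier, and sets that are reached at different
times from different points are reached with positive probability at a common time.\<close>

definition lazy_avg :: "nat \<Rightarrow> (nat \<Rightarrow> 'a \<Rightarrow> 'a) \<Rightarrow> ('a \<Rightarrow> real) \<Rightarrow> 'a \<Rightarrow> real" where
  "lazy_avg k g u x = (u x + (\<Sum>i=1..k. u (g i x)) / k) / 2"

definition lower_bounds_of :: "'a set \<Rightarrow> nat \<Rightarrow> (nat \<Rightarrow> 'a \<Rightarrow> 'a) \<Rightarrow> ('a \<Rightarrow> real) \<Rightarrow> real set" where
  "lower_bounds_of X k g u = {c. \<exists>n. \<forall>x\<in>X. c \<le> (lazy_avg k g ^^ n) u x}"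

text \<open>A substitute for integration against a stationary measure. The infimum over \<open>X\<close> of the
\<open>n\<close>-step average does not decrease with \<open>n\<close>; its supremum is a superadditive functional, at most
the integral of \<open>u\<close> against any stationary measure.\<close>

definition lower_mean :: "'a set \<Rightarrow> nat \<Rightarrow> (nat \<Rightarrow> 'a \<Rightarrow> 'a) \<Rightarrow> ('a \<Rightarrow> real) \<Rightarrow> real" where
  "lower_mean X k g u = Sup (lower_bounds_of X k g u)"

definition bounded_fun_on :: "'a set \<Rightarrow> ('a \<Rightarrow> real) \<Rightarrow> bool" where
  "bounded_fun_on X u \<longleftrightarrow> (\<exists>B. \<forall>x\<in>X. \<bar>u x\<bar> \<le> B)"

locale finite_walk =
  fixes X :: "'a set" and k :: nat and g :: "nat \<Rightarrow> 'a \<Rightarrow> 'a"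
  assumes X_nonempty: "X \<noteq> {}"
    and k_pos: "k \<ge> 1"
    and g_closed: "\<And>i x. i \<in> {1..k} \<Longrightarrow> x \<in> X \<Longrightarrow> g i x \<in> X"
begin

abbreviation "L \<equiv> lazy_avg k g"
abbreviation "mean \<equiv> lower_mean X k g"
abbreviation "LB \<equiv> lower_bounds_of X k g"

lemma avg_const: "(\<Sum>i=1..k. (c::real)) / k = c"
  using k_pos by simp

lemma lazy_avg_ge:
  assumes "\<And>x. x \<in> X \<Longrightarrow> c \<le> u x" "x \<in> X"
  shows "c \<le> L u x"
proof -
  have "(\<Sum>i=1..k. c) \<le> (\<Sum>i=1..k. u (g i x))"
    by (rule sum_mono) (auto intro!: assms g_closed)
  then have "c \<le> (\<Sum>i=1..k. u (g i x)) / k"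
    using k_pos by (simp add: field_simps)
  with assms show ?thesis by (force simp: lazy_avg_def)
qed

lemma lazy_avg_mono:
  assumes "\<And>x. x \<in> X \<Longrightarrow> u x \<le> v x" "x \<in> X"
  shows "L u x \<le> L v x"
  unfolding lazy_avg_def
  by (intro divide_right_mono add_mono sum_mono assms g_closed) auto

lemma lazy_avg_pow_mono:
  assumes "\<And>x. x \<in> X \<Longrightarrow> u x \<le> v x" "x \<in> X"
  shows "(L ^^ n) u x \<le> (L ^^ n) v x"
  using assms(2) by (induction n arbitrary: x) (auto intro!: lazy_avg_mono assms(1))

lemma lazy_avg_pow_ge:
  assumes "\<And>x. x \<in> X \<Longrightarrow> c \<le> u x" "x \<in> X"
  shows "c \<le> (L ^^ n) u x"
  using assms(2) by (induction n arbitrary: x) (auto intro!: lazy_avg_ge assms(1))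

lemma lazy_avg_add: "L (\<lambda>x. u x + v x) = (\<lambda>x. L u x + L v x)"
  by (rule ext) (simp add: lazy_avg_def sum.distrib add_divide_distrib)

lemma lazy_avg_pow_add: "(L ^^ n) (\<lambda>x. u x + v x) = (\<lambda>x. (L ^^ n) u x + (L ^^ n) v x)"
  by (induction n) (auto simp: lazy_avg_add)

lemma lazy_avg_scale: "L (\<lambda>x. a * u x) = (\<lambda>x. a * L u x)"
  by (rule ext) (simp add: lazy_avg_def sum_distrib_left [symmetric] algebra_simps)

lemma lazy_avg_pow_scale: "(L ^^ n) (\<lambda>x. a * u x) = (\<lambda>x. a * (L ^^ n) u x)"
  by (induction n) (auto simp: lazy_avg_scale)

lemma LB_persistent:
  assumes "\<forall>x\<in>X. c \<le> (L ^^ n) u x" "n \<le> n'" "x \<in> X"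
  shows "c \<le> (L ^^ n') u x"
proof -
  obtain d where d: "n' = d + n" using assms(2) le_Suc_ex by (metis add.commute)
  show ?thesis unfolding d funpow_add o_def
    by (rule lazy_avg_pow_ge) (use assms in auto)
qed

lemma LB_nonempty: "bounded_fun_on X u \<Longrightarrow> LB u \<noteq> {}"
proof -
  assume "bounded_fun_on X u"
  then obtain B where B: "\<And>x. x \<in> X \<Longrightarrow> \<bar>u x\<bar> \<le> B" unfolding bounded_fun_on_def by blast
  have "- B \<in> LB u" unfolding lower_bounds_of_def using B by (force intro!: exI[of _ 0])
  then show ?thesis by blast
qed

lemma LB_le:
  assumes "\<And>x. x \<in> X \<Longrightarrow> u x \<le> B" "c \<in> LB u"
  shows "c \<le> B"
proof -
  obtain n where n: "\<forall>x\<in>X. c \<le> (L ^^ n) u x" using assms(2) unfolding lower_bounds_of_def by blast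
  obtain x where x: "x \<in> X" using X_nonempty by blast
  have "(L ^^ n) (\<lambda>_. B) = (\<lambda>_. B)"
    by (induction n) (use avg_const in \<open>auto simp: lazy_avg_def\<close>)
  then show ?thesis using n x lazy_avg_pow_mono[of u "\<lambda>_. B" x n] assms(1) by force
qed

lemma LB_bdd: "bounded_fun_on X u \<Longrightarrow> bdd_above (LB u)"
proof -
  assume "bounded_fun_on X u"
  then obtain B where B: "\<And>x. x \<in> X \<Longrightarrow> \<bar>u x\<bar> \<le> B" unfolding bounded_fun_on_def by blast
  have "c \<le> B" if "c \<in> LB u" for c
    by (rule LB_le[OF _ that]) (use B abs_le_D1 in blast)
  then show ?thesis by (rule bdd_aboveI)
qed

lemma mean_ge:
  assumes "bounded_fun_on X u" "\<And>x. x \<in> X \<Longrightarrow> c \<le> (L ^^ n) u x"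
  shows "c \<le> mean u"
  unfolding lower_mean_def
proof (rule cSup_upper[OF _ LB_bdd[OF assms(1)]])
  show "c \<in> LB u" unfolding lower_bounds_of_def using assms(2) by blast
qed

lemma mean_le:
  assumes "bounded_fun_on X u" "\<And>x. x \<in> X \<Longrightarrow> u x \<le> c"
  shows "mean u \<le> c"
  unfolding lower_mean_def
  by (rule cSup_least[OF LB_nonempty[OF assms(1)]]) (rule LB_le[OF assms(2)])

lemma mean_mono:
  assumes "bounded_fun_on X u" "bounded_fun_on X v" "\<And>x. x \<in> X \<Longrightarrow> u x \<le> v x"
  shows "mean u \<le> mean v"
  unfolding lower_mean_def
proof (rule cSup_subset_mono[OF LB_nonempty[OF assms(1)] LB_bdd[OF assms(2)]])
  show "LB u \<subseteq> LB v"
  proof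
    fix c assume "c \<in> LB u"
    then obtain n where n: "\<forall>x\<in>X. c \<le> (L ^^ n) u x" unfolding lower_bounds_of_def by blast
    have "c \<le> (L ^^ n) v x" if "x \<in> X" for x
      using n that lazy_avg_pow_mono[of u v x n] assms(3) order_trans by blast
    then show "c \<in> LB v" unfolding lower_bounds_of_def by blast
  qed
qed

lemma mean_nonneg: "bounded_fun_on X u \<Longrightarrow> (\<And>x. x \<in> X \<Longrightarrow> 0 \<le> u x) \<Longrightarrow> 0 \<le> mean u"
  using mean_ge[where n=0 and c=0 and u=u] by simp

lemma bounded_fun_on_add: "bounded_fun_on X u \<Longrightarrow> bounded_fun_on X v \<Longrightarrow> bounded_fun_on X (\<lambda>x. u x + v x)"
  unfolding bounded_fun_on_def
proof (elim exE)
  fix B C assume B: "\<forall>x\<in>X. \<bar>u x\<bar> \<le> B" and C: "\<forall>x\<in>X. \<bar>v x\<bar> \<le> C"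
  have "\<bar>u x + v x\<bar> \<le> B + C" if "x \<in> X" for x
    using bspec[OF B that] bspec[OF C that] by linarith
  then show "\<exists>B. \<forall>x\<in>X. \<bar>u x + v x\<bar> \<le> B" by blast
qed

lemma bounded_fun_on_scale: "bounded_fun_on X u \<Longrightarrow> bounded_fun_on X (\<lambda>x. a * u x)"
  unfolding bounded_fun_on_def abs_mult
proof (elim exE)
  fix B assume B: "\<forall>x\<in>X. \<bar>u x\<bar> \<le> B"
  have "\<bar>a\<bar> * \<bar>u x\<bar> \<le> \<bar>a\<bar> * B" if "x \<in> X" for x
    by (rule mult_left_mono) (use B that in auto)
  then show "\<exists>B. \<forall>x\<in>X. \<bar>a\<bar> * \<bar>u x\<bar> \<le> B" by blast
qed

lemma bounded_fun_on_zero: "bounded_fun_on X (\<lambda>x. 0)"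
  unfolding bounded_fun_on_def by auto

lemma bounded_fun_on_sum:
  "finite A \<Longrightarrow> (\<And>i. i \<in> A \<Longrightarrow> bounded_fun_on X (u i)) \<Longrightarrow> bounded_fun_on X (\<lambda>x. \<Sum>i\<in>A. u i x)"
  by (induction A rule: finite_induct) (auto intro: bounded_fun_on_add bounded_fun_on_zero)

lemma bounded_fun_on_shift:
  "i \<in> {1..k} \<Longrightarrow> bounded_fun_on X u \<Longrightarrow> bounded_fun_on X (\<lambda>x. u (g i x))"
  unfolding bounded_fun_on_def using g_closed by blast

text \<open>Lower bounds valid at times \<open>a\<close> and \<open>b\<close> are both valid at the later of these times
(\<open>LB_persistent\<close>), and there they can be added.\<close>

lemma mean_superadditive:
  assumes "bounded_fun_on X u" "bounded_fun_on X v"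
  shows "mean u + mean v \<le> mean (\<lambda>x. u x + v x)"
proof -
  have *: "c + d \<le> mean (\<lambda>x. u x + v x)" if c: "c \<in> LB u" and d: "d \<in> LB v" for c d
  proof -
    from c d obtain a b where ab: "\<forall>x\<in>X. c \<le> (L ^^ a) u x" "\<forall>x\<in>X. d \<le> (L ^^ b) v x"
      unfolding lower_bounds_of_def by blast
    show ?thesis
    proof (rule mean_ge[where n="max a b", OF bounded_fun_on_add[OF assms]])
      fix x assume "x \<in> X"
      then show "c + d \<le> (L ^^ max a b) (\<lambda>x. u x + v x) x"
        using LB_persistent[OF ab(1), of "max a b" x] LB_persistent[OF ab(2), of "max a b" x]
        by (simp add: lazy_avg_pow_add)
    qed
  qed
  have "mean u \<le> mean (\<lambda>x. u x + v x) - d" if d: "d \<in> LB v" for d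
    unfolding lower_mean_def[of X k g u]
    by (rule cSup_least[OF LB_nonempty[OF assms(1)]]) (use * d in force)
  then have "mean v \<le> mean (\<lambda>x. u x + v x) - mean u"
    unfolding lower_mean_def[of X k g v]
    by (intro cSup_least[OF LB_nonempty[OF assms(2)]]) force
  then show ?thesis by simp
qed

lemma mean_sum_superadditive:
  assumes "finite A" "\<And>i. i \<in> A \<Longrightarrow> bounded_fun_on X (u i)"
  shows "(\<Sum>i\<in>A. mean (u i)) \<le> mean (\<lambda>x. \<Sum>i\<in>A. u i x)"
  using assms
proof (induction A rule: finite_induct)
  case empty
  then show ?case using mean_nonneg[OF bounded_fun_on_zero] by simp
next
  case (insert i A)
  have "(\<Sum>i\<in>insert i A. mean (u i)) \<le> mean (u i) + mean (\<lambda>x. \<Sum>i\<in>A. u i x)" using insert by simp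
  also have "\<dots> \<le> mean (\<lambda>x. u i x + (\<Sum>i\<in>A. u i x))"
    by (intro mean_superadditive bounded_fun_on_sum) (use insert in auto)
  finally show ?case using insert by simp
qed

lemma mean_scale:
  assumes "bounded_fun_on X u" "a > 0"
  shows "mean (\<lambda>x. a * u x) = a * mean u"
proof -
  have *: "a * mean u \<le> mean (\<lambda>x. a * u x)" if a: "a > 0" and u: "bounded_fun_on X u" for a u
  proof -
    have "mean u \<le> mean (\<lambda>x. a * u x) / a"
      unfolding lower_mean_def[of X k g u]
    proof (rule cSup_least[OF LB_nonempty[OF u]])
      fix c assume "c \<in> LB u"
      then obtain n where "\<forall>x\<in>X. c \<le> (L ^^ n) u x" unfolding lower_bounds_of_def by blast
      then have "a * c \<le> mean (\<lambda>x. a * u x)"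
        by (intro mean_ge[where n=n] bounded_fun_on_scale u) (use a in \<open>auto simp: lazy_avg_pow_scale\<close>)
      then show "c \<le> mean (\<lambda>x. a * u x) / a" using a by (simp add: field_simps)
    qed
    then show ?thesis using a by (simp add: field_simps)
  qed
  have "1/a * mean (\<lambda>x. a * u x) \<le> mean (\<lambda>x. 1/a * (a * u x))"
    by (rule *) (use assms in \<open>auto intro: bounded_fun_on_scale\<close>)
  then have "mean (\<lambda>x. a * u x) \<le> a * mean u" using assms by (simp add: field_simps)
  with *[OF assms(2,1)] show ?thesis by simp
qed

lemma mean_lazy_avg_le:
  assumes "bounded_fun_on X u" "bounded_fun_on X (L u)"
  shows "mean (L u) \<le> mean u"
  unfolding lower_mean_def
proof (rule cSup_subset_mono[OF LB_nonempty[OF assms(2)] LB_bdd[OF assms(1)]])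
  show "LB (L u) \<subseteq> LB u"
  proof
    fix c assume "c \<in> LB (L u)"
    then obtain n where "\<forall>x\<in>X. c \<le> (L ^^ n) (L u) x" unfolding lower_bounds_of_def by blast
    then have "\<forall>x\<in>X. c \<le> (L ^^ Suc n) u x" by (simp add: funpow_swap1)
    then show "c \<in> LB u" unfolding lower_bounds_of_def by blast
  qed
qed

text \<open>Write \<open>T\<close> for the average over one step that is not lazy, so that \<open>u + T u\<close> is twice the lazy average of \<open>u\<close>.
Superadditivity bounds \<open>mean u + mean (T u)\<close> by \<open>2 * mean (L u)\<close>, and lower bounds for the iterates
of \<open>L u\<close> are lower bounds for those of \<open>u\<close>, so \<open>mean (L u) \<le> mean u\<close>. Together these give
\<open>mean (T u) \<le> mean u\<close>.\<close>

lemma mean_superharmonic: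
  assumes u: "bounded_fun_on X u"
  shows "(\<Sum>i=1..k. mean (\<lambda>x. u (g i x))) \<le> k * mean u"
proof -
  let ?T = "\<lambda>x. (1/k) * (\<Sum>i=1..k. u (g i x))"
  have bS: "bounded_fun_on X (\<lambda>x. \<Sum>i=1..k. u (g i x))"
    by (rule bounded_fun_on_sum) (auto intro: bounded_fun_on_shift u)
  then have bT: "bounded_fun_on X ?T" by (rule bounded_fun_on_scale)
  have Lu: "L u = (\<lambda>x. (1/2) * (u x + ?T x))" by (auto simp: lazy_avg_def)
  have bL: "bounded_fun_on X (L u)" unfolding Lu
    by (rule bounded_fun_on_scale[OF bounded_fun_on_add[OF u bT]])
  have "mean u + mean ?T \<le> mean (\<lambda>x. u x + ?T x)" by (rule mean_superadditive[OF u bT])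
  also have "\<dots> = 2 * mean (L u)" unfolding Lu
    using mean_scale[OF bounded_fun_on_add[OF u bT], of "1/2"] by simp
  also have "\<dots> \<le> 2 * mean u" using mean_lazy_avg_le[OF u bL] by simp
  finally have "mean ?T \<le> mean u" by simp
  moreover have "mean ?T = (1/k) * mean (\<lambda>x. \<Sum>i=1..k. u (g i x))"
    by (rule mean_scale[OF bS]) (use k_pos in simp)
  moreover have "k * mean ?T \<le> k * mean u" using \<open>mean ?T \<le> mean u\<close> by (rule mult_left_mono) simp
  ultimately have "mean (\<lambda>x. \<Sum>i=1..k. u (g i x)) \<le> k * mean u" using k_pos by simp
  moreover have "(\<Sum>i=1..k. mean (\<lambda>x. u (g i x))) \<le> mean (\<lambda>x. \<Sum>i=1..k. u (g i x))"
    by (rule mean_sum_superadditive) (auto intro: bounded_fun_on_shift u)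
  ultimately show ?thesis by linarith
qed

text \<open>A path of length at most \<open>n\<close> that ends in \<open>V\<close>, completed by lazy steps to length exactly \<open>n\<close>, has
probability at least \<open>(1 / (2 * k)) ^ n\<close>.\<close>

lemma mean_pos_of_reachable:
  assumes hit: "\<And>x. x \<in> X \<Longrightarrow> \<exists>s\<in>lists {1..k}. length s \<le> n \<and> fold g s x \<in> V"
  shows "mean (indicator V) \<ge> (1 / (2 * k)) ^ n" 
proof -
  have b: "bounded_fun_on X (indicator V)" unfolding bounded_fun_on_def
    by (auto simp: indicator_def intro!: exI[of _ 1])
  have pos: "0 \<le> (L ^^ n) (indicator V) x" if "x \<in> X" for n x
    by (rule lazy_avg_pow_ge) (use that in auto)
  have *: "x \<in> X \<Longrightarrow> s \<in> lists {1..k} \<Longrightarrow> length s \<le> n \<Longrightarrow> fold g s x \<in> V \<Longrightarrow>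
      (1 / (2 * k)) ^ n \<le> (L ^^ n) (indicator V) x" for s n x
  proof (induction n arbitrary: s x)
    case 0 then show ?case by simp
  next
    case (Suc n)
    let ?u = "(L ^^ n) (indicator V)"
    have S: "0 \<le> ?u (g i x)" if "i \<in> {1..k}" for i using pos Suc.prems that g_closed by blast
    show ?case
    proof (cases s)
      case Nil
      have "(1 / (2 * k)) ^ n \<le> ?u x" using Suc.IH[of x s] Suc.prems Nil by simp
      moreover have "0 \<le> (\<Sum>i=1..k. ?u (g i x)) / k" by (intro divide_nonneg_nonneg sum_nonneg S) auto
      ultimately have "(1 / (2 * k)) ^ n / 2 \<le> L ?u x" unfolding lazy_avg_def[of k g ?u x] by simp
      moreover have "(1 / (2 * k)) ^ Suc n \<le> (1 / (2 * real k)) ^ n / 2"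
        using k_pos by (simp add: field_simps)
      ultimately show ?thesis by simp
    next
      case (Cons i s')
      then have i: "i \<in> {1..k}" using Suc.prems by auto
      have "(1 / (2 * k)) ^ n \<le> ?u (g i x)"
        by (rule Suc.IH[of _ s']) (use Suc.prems Cons i g_closed in auto)
      also have "\<dots> \<le> (\<Sum>i=1..k. ?u (g i x))" by (rule member_le_sum[OF i]) (use S in auto)
      finally have "(1 / (2 * k)) ^ n / k \<le> (\<Sum>i=1..k. ?u (g i x)) / k" by (rule divide_right_mono) simp
      moreover have "0 \<le> ?u x" using pos Suc.prems by blast
      ultimately have "(1 / (2 * k)) ^ n / k / 2 \<le> L ?u x" unfolding lazy_avg_def[of k g ?u x] by simp
      moreover have "(1 / (2 * k)) ^ Suc n = (1 / (2 * real k)) ^ n / k / 2"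
        by (simp add: field_simps)
      ultimately show ?thesis by simp
    qed
  qed
  show ?thesis
    by (rule mean_ge[where n=n, OF b]) (meson hit *)
qed

end

section \<open>Words whose survivors have small mean\<close>

text \<open>If the maps \<open>g i\<close> are the inverses of given maps, a point belongs to \<open>avoiding X g U r\<close> iff it is the endpoint
of an orbit of the given maps
along the reversed word that stays outside \<open>U\<close> from its second point on. In particular it
contains the endpoints of all orbits along the reversed word that avoid \<open>U\<close> altogether.\<close>

definition avoiding :: "'a set \<Rightarrow> (nat \<Rightarrow> 'a \<Rightarrow> 'a) \<Rightarrow> 'a set \<Rightarrow> nat list \<Rightarrow> 'a set" where
  "avoiding X g U r = {x \<in> X. \<forall>j<length r. fold g (take j r) x \<notin> U}"

lemma avoiding_Nil: "avoiding X g U [] = X"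
  by (simp add: avoiding_def)

lemma avoiding_Cons:
  assumes "x \<in> X" "g i x \<in> X"
  shows "x \<in> avoiding X g U (i # r) \<longleftrightarrow> x \<notin> U \<and> g i x \<in> avoiding X g U r"
proof -
  have "(\<forall>j<Suc (length r). fold g (take j (i # r)) x \<notin> U) \<longleftrightarrow>
        x \<notin> U \<and> (\<forall>j<length r. fold g (take j r) (g i x) \<notin> U)"
    unfolding All_less_Suc2 by simp
  then show ?thesis using assms by (simp add: avoiding_def)
qed

lemma avoiding_snoc:
  "x \<in> avoiding X g U (r @ [i]) \<longleftrightarrow> x \<in> avoiding X g U r \<and> fold g r x \<notin> U"
  by (auto simp: avoiding_def less_Suc_eq)

context finite_walk begin

text \<open>The transition operator of the walk killed in \<open>U\<close>: its \<open>n\<close>-th power applied to the constant one is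
the probability that the walk is outside \<open>U\<close> at the times \<open>0, \<dots>, n - 1\<close>.\<close>

definition killed_avg :: "'a set \<Rightarrow> ('a \<Rightarrow> real) \<Rightarrow> 'a \<Rightarrow> real" where
  "killed_avg U u x = (if x \<in> U then 0 else (\<Sum>i=1..k. u (g i x)) / k)"

lemma killed_avg_bounds:
  assumes "\<And>x. x \<in> X \<Longrightarrow> 0 \<le> u x \<and> u x \<le> c" "x \<in> X"
  shows "0 \<le> (killed_avg U ^^ n) u x \<and> (killed_avg U ^^ n) u x \<le> c"
  using assms(2)
proof (induction n arbitrary: x)
  case 0 then show ?case using assms by simp
next
  case (Suc n)
  let ?u = "(killed_avg U ^^ n) u"
  have b: "0 \<le> ?u (g i x)" "?u (g i x) \<le> c" if "i \<in> {1..k}" for i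
    using Suc.IH[OF g_closed[OF that Suc.prems]] by auto
  have "0 \<le> (\<Sum>i=1..k. ?u (g i x)) / k" by (intro divide_nonneg_nonneg sum_nonneg b) auto
  moreover have "(\<Sum>i=1..k. ?u (g i x)) \<le> (\<Sum>i=1..k. c)" by (intro sum_mono b)
  then have "(\<Sum>i=1..k. ?u (g i x)) / k \<le> c" using k_pos by (simp add: field_simps)
  moreover have "0 \<le> c" using assms(1)[OF Suc.prems] by linarith
  ultimately show ?case by (simp add: killed_avg_def[of U ?u x])
qed

text \<open>Among the paths of length \<open>n\<close>, one follows \<open>s\<close> into \<open>U\<close> and is killed; it has
probability \<open>(1 / k) ^ n\<close>.\<close>

lemma killed_avg_decay:
  assumes bounds: "\<And>x. x \<in> X \<Longrightarrow> 0 \<le> u x \<and> u x \<le> c"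
    and "x \<in> X" "s \<in> lists {1..k}" "length s < n" "fold g s x \<in> U"
  shows "(killed_avg U ^^ n) u x \<le> c * (1 - (1 / k) ^ n)"
  using assms(2-)
proof (induction n arbitrary: s x)
  case 0 then show ?case by simp
next
  case (Suc n)
  let ?u = "(killed_avg U ^^ n) u"
  have c0: "0 \<le> c" using bounds[OF Suc.prems(1)] by linarith
  have q: "(1 / k) ^ n \<le> (1::real)" for n using k_pos by (intro power_le_one) auto
  show ?case
  proof (cases "x \<in> U")
    case True
    then have "(killed_avg U ^^ Suc n) u x = 0" by (simp add: killed_avg_def)
    then show ?thesis using q[of "Suc n"] c0 by simp
  next
    case False
    then obtain i s' where s: "s = i # s'" using Suc.prems by (cases s) auto
    then have i: "i \<in> {1..k}" using Suc.prems by auto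
    have IH: "?u (g i x) \<le> c * (1 - (1 / k) ^ n)"
      by (rule Suc.IH[of _ s']) (use Suc.prems s i g_closed in auto)
    have "(\<Sum>i=1..k. ?u (g i x)) = ?u (g i x) + (\<Sum>j\<in>{1..k} - {i}. ?u (g j x))"
      by (rule sum.remove) (use i in auto)
    also have "(\<Sum>j\<in>{1..k} - {i}. ?u (g j x)) \<le> (\<Sum>j\<in>{1..k} - {i}. c)"
    proof (rule sum_mono)
      fix j assume "j \<in> {1..k} - {i}"
      then have "g j x \<in> X" using g_closed Suc.prems(1) by simp
      then show "?u (g j x) \<le> c" using killed_avg_bounds[of u c, OF bounds] by simp
    qed
    also have "\<dots> = (real k - 1) * c" using i by (simp add: of_nat_diff)
    finally have "(\<Sum>i=1..k. ?u (g i x)) \<le> c * (1 - (1 / k) ^ n) + (real k - 1) * c" using IH by linarith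
    also have "\<dots> = k * (c * (1 - (1 / k) ^ Suc n))" using k_pos by (simp add: field_simps)
    finally have "(\<Sum>i=1..k. ?u (g i x)) / k \<le> c * (1 - (1 / k) ^ Suc n)"
      using k_pos by (simp add: pos_divide_le_eq mult.commute)
    then show ?thesis using False by (simp add: killed_avg_def[of U ?u x])
  qed
qed

text \<open>The contribution of the single path \<open>r\<close> to the killed average over \<open>length r\<close> steps, up to the
factor \<open>(1 / k) ^ length r\<close>.\<close>

definition pull :: "'a set \<Rightarrow> nat list \<Rightarrow> ('a \<Rightarrow> real) \<Rightarrow> 'a \<Rightarrow> real" where
  "pull U r u x = indicator (avoiding X g U r) x * u (fold g r x)"

lemma fold_closed: "r \<in> lists {1..k} \<Longrightarrow> x \<in> X \<Longrightarrow> fold g r x \<in> X"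
  using fold_in_closed[of k X g] g_closed by blast

lemma pull_killed_avg:
  "pull U r (killed_avg U u) x = (1 / k) * (\<Sum>i=1..k. pull U (r @ [i]) u x)"
proof (cases "x \<in> avoiding X g U r \<and> fold g r x \<notin> U")
  case True
  then have "pull U (r @ [i]) u x = u (g i (fold g r x))" for i
    using avoiding_snoc[of x X g U r i] by (simp add: pull_def)
  then show ?thesis using True by (simp add: pull_def[of U r] killed_avg_def del: One_nat_def)
next
  case False
  then have "pull U (r @ [i]) u x = 0" for i by (auto simp: pull_def avoiding_snoc)
  moreover have "pull U r (killed_avg U u) x = 0"
    using False by (auto simp: pull_def killed_avg_def)
  ultimately show ?thesis by simp
qed

lemma pull_bounded:
  assumes "\<And>x. x \<in> X \<Longrightarrow> 0 \<le> u x \<and> u x \<le> 1" "r \<in> lists {1..k}"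
  shows "bounded_fun_on X (pull U r u)"
  unfolding bounded_fun_on_def
proof (intro exI ballI)
  fix x assume "x \<in> X"
  then show "\<bar>pull U r u x\<bar> \<le> 1" 
    using assms(1)[OF fold_closed[OF assms(2) \<open>x \<in> X\<close>]]
    by (auto simp: pull_def indicator_def)
qed

text \<open>The killed average is the average over all words of length \<open>n\<close> of the indicators of the sets
\<open>avoiding X g U r\<close>. Choosing the letters of the word one at a time, superadditivity of the mean
always leaves a letter for which the mean stays below \<open>\<delta>\<close>.\<close>

lemma select_avoiding_word:
  assumes "mean (pull U r ((killed_avg U ^^ n) (\<lambda>_. 1))) < \<delta>" "r \<in> lists {1..k}"
  shows "\<exists>r'\<in>lists {1..k}. mean (pull U r' (\<lambda>_. 1)) < \<delta>"
  using assms
proof (induction n arbitrary: r)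
  case 0 then show ?case by auto
next
  case (Suc n)
  let ?u = "(killed_avg U ^^ n) (\<lambda>_. 1)"
  have u: "0 \<le> ?u x \<and> ?u x \<le> 1" if "x \<in> X" for x
    by (rule killed_avg_bounds) (use that in auto)
  have b: "bounded_fun_on X (pull U (r @ [i]) ?u)" if "i \<in> {1..k}" for i
    by (rule pull_bounded) (use u that Suc.prems in auto)
  show ?case
  proof (rule ccontr)
    assume contra: "\<not> ?case"
    have ge: "\<delta> \<le> mean (pull U (r @ [i]) ?u)" if "i \<in> {1..k}" for i
      using Suc.IH[of "r @ [i]"] contra that Suc.prems by fastforce
    have "k * \<delta> = (\<Sum>i=1..k. \<delta>)" by simp
    also have "\<dots> \<le> (\<Sum>i=1..k. mean (pull U (r @ [i]) ?u))" by (rule sum_mono) (rule ge)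
    also have "\<dots> \<le> mean (\<lambda>x. \<Sum>i=1..k. pull U (r @ [i]) ?u x)"
      by (rule mean_sum_superadditive) (use b in auto)
    finally have "\<delta> \<le> (1 / k) * mean (\<lambda>x. \<Sum>i=1..k. pull U (r @ [i]) ?u x)"
      using k_pos by (simp add: field_simps)
    also have "\<dots> = mean (\<lambda>x. (1 / k) * (\<Sum>i=1..k. pull U (r @ [i]) ?u x))"
      by (rule mean_scale[symmetric]) (use b k_pos in \<open>auto intro: bounded_fun_on_sum\<close>)
    also have "\<dots> = mean (pull U r ((killed_avg U ^^ Suc n) (\<lambda>_. 1)))"
      by (simp add: pull_killed_avg[abs_def])
    finally show False using Suc.prems by simp
  qed
qed

text \<open>Whatever the starting point, the killed walk loses a fixed proportion of its mass within \<open>Suc n\<close>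
steps, so that its mass tends to zero uniformly, and with it the average over all words of a given
length of the means of their avoiding sets.\<close>

lemma avoiding_small_mean:
  assumes hit: "\<And>x. x \<in> X \<Longrightarrow> \<exists>s\<in>lists {1..k}. length s \<le> n \<and> fold g s x \<in> U"
    and "\<delta> > 0"
  shows "\<exists>r\<in>lists {1..k}. mean (indicator (avoiding X g U r)) < \<delta>"
proof -
  \<comment> \<open>The hitting path has length at most \<open>n\<close>, and one more step of the killed walk is needed to remove the mass.\<close>
  define q where "q = 1 - (1 / real k) ^ Suc n"
  have "(1 / real k) ^ Suc n \<le> 1" by (rule power_le_one) (use k_pos in auto)
  moreover have "0 < (1 / real k) ^ Suc n" using k_pos by (intro zero_less_power) simp
  ultimately have q: "0 \<le> q" "q < 1" unfolding q_def by linarith+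
  have decay: "(killed_avg U ^^ (Suc n * j)) (\<lambda>_. 1) x \<le> q ^ j" if "x \<in> X" for j x
    using that
  proof (induction j arbitrary: x)
    case 0 then show ?case by simp
  next
    case (Suc j)
    obtain s where s: "s \<in> lists {1..k}" "length s < Suc n" "fold g s x \<in> U" 
      using hit[OF Suc.prems] by (auto simp: less_Suc_eq_le)
    have "(killed_avg U ^^ Suc n) ((killed_avg U ^^ (Suc n * j)) (\<lambda>_. 1)) x \<le> q ^ j * (1 - (1 / k) ^ Suc n)"
    proof (rule killed_avg_decay[OF _ Suc.prems s])
      fix y assume y: "y \<in> X"
      show "0 \<le> (killed_avg U ^^ (Suc n * j)) (\<lambda>_. 1) y \<and> (killed_avg U ^^ (Suc n * j)) (\<lambda>_. 1) y \<le> q ^ j"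
        using Suc.IH[OF y] killed_avg_bounds[where u="\<lambda>_. 1" and c=1 and x=y and U=U and n="Suc n * j"] y by simp
    qed
    moreover have "Suc n * Suc j = Suc n + Suc n * j" by simp
    ultimately show ?case unfolding q_def[symmetric]
      by (simp only: funpow_add o_apply power_Suc mult.commute)
  qed
  obtain j where j: "q ^ j < \<delta>" using real_arch_pow_inv[OF \<open>\<delta> > 0\<close> q(2)] by blast
  let ?u = "(killed_avg U ^^ (Suc n * j)) (\<lambda>_. 1)"
  have "mean (pull U [] ?u) \<le> q ^ j"
  proof (rule mean_le)
    show "bounded_fun_on X (pull U [] ?u)"
      by (rule pull_bounded) (use killed_avg_bounds[where u="\<lambda>_. 1" and c=1] in auto)
  qed (use decay in \<open>auto simp: pull_def avoiding_Nil\<close>)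
  then obtain r where r: "r \<in> lists {1..k}" "mean (pull U r (\<lambda>_. 1)) < \<delta>"
    using select_avoiding_word[where U=U and r="[]" and n="Suc n * j" and \<delta>=\<delta>] j by auto
  then show ?thesis by (auto simp: pull_def[abs_def])
qed

end

section \<open>A minimum principle on the tree of words\<close>

text \<open>Superharmonic functions on the tree of words cannot be everywhere large at the hitting vertices
and small at the root. If \<open>\<iota>\<close> is the infimum of \<open>G\<close>, the excess \<open>G v - \<iota>\<close> is at least
\<open>(1 / k) ^ length u\<close> times the excess at \<open>v @ u\<close>. As from every vertex a value \<open>\<ge> s\<close> is within
distance \<open>n\<close>, the excess is everywhere at least \<open>(1 / k) ^ n * (s - \<iota>)\<close>, which contradicts the definition of
\<open>\<iota>\<close> unless \<open>s \<le> \<iota>\<close>.\<close>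

lemma tree_minimum_principle:
  fixes G :: "nat list \<Rightarrow> real"
  assumes k: "k \<ge> 1"
    and nonneg: "\<And>v. v \<in> lists {1..k} \<Longrightarrow> 0 \<le> G v"
    and super: "\<And>v. v \<in> lists {1..k} \<Longrightarrow> (\<Sum>i=1..k. G (v @ [i])) \<le> k * G v"
    and reach: "\<And>v. v \<in> lists {1..k} \<Longrightarrow> \<exists>u\<in>lists {1..k}. length u \<le> n \<and> s \<le> G (v @ u)"
  shows "s \<le> G []"
proof -
  define \<iota> where "\<iota> = Inf (G ` lists {1..k})"
  have bdd: "bdd_below (G ` lists {1..k})" using nonneg by (auto simp: bdd_below_def)
  have \<iota>_le: "\<iota> \<le> G v" if "v \<in> lists {1..k}" for v
    unfolding \<iota>_def by (rule cINF_lower[OF bdd that])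
  \<comment> \<open>The excess at a vertex is at least \<open>1 / k\<close> times that at each child, as the other children have nonnegative excess.\<close>
  have excess: "(1 / k) ^ length u * (G (v @ u) - \<iota>) \<le> G v - \<iota>"
    if "v \<in> lists {1..k}" "u \<in> lists {1..k}" for u v
    using that
  proof (induction u arbitrary: v)
    case Nil then show ?case by simp
  next
    case (Cons i u)
    then have i: "i \<in> {1..k}" by auto
    have "G (v @ [i]) - \<iota> \<le> (\<Sum>i=1..k. G (v @ [i]) - \<iota>)"
      by (rule member_le_sum[OF i]) (use Cons \<iota>_le in auto)
    also have "\<dots> \<le> k * (G v - \<iota>)"
      using super[of v] Cons by (simp add: sum_subtractf algebra_simps)
    finally have 1: "(1/k) * (G (v @ [i]) - \<iota>) \<le> G v - \<iota>" using k by (simp add: field_simps)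
    have "(1 / k) ^ length u * (G ((v @ [i]) @ u) - \<iota>) \<le> G (v @ [i]) - \<iota>"
      by (rule Cons.IH) (use Cons i in auto)
    then have "(1/k) * ((1 / k) ^ length u * (G ((v @ [i]) @ u) - \<iota>)) \<le> (1/k) * (G (v @ [i]) - \<iota>)"
      by (rule mult_left_mono) simp
    with 1 show ?case by (simp add: mult.assoc)
  qed
  have "s \<le> \<iota>"
  proof (rule ccontr)
    assume "\<not> s \<le> \<iota>"
    define d where "d = (1 / k) ^ n * (s - \<iota>)"
    have "d > 0" unfolding d_def using \<open>\<not> s \<le> \<iota>\<close> k by simp
    have "\<iota> + d \<le> G v" if v: "v \<in> lists {1..k}" for v
    proof -
      obtain u where u: "u \<in> lists {1..k}" "length u \<le> n" "s \<le> G (v @ u)" using reach[OF v] by blast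
      have "d \<le> (1 / k) ^ length u * (G (v @ u) - \<iota>)" unfolding d_def
        by (intro mult_mono power_decreasing) (use u \<open>\<not> s \<le> \<iota>\<close> k in auto)
      also have "\<dots> \<le> G v - \<iota>" by (rule excess[OF v u(1)])
      finally show ?thesis by simp
    qed
    then have "\<iota> + d \<le> \<iota>" unfolding \<iota>_def by (intro cINF_greatest) auto
    then show False using \<open>d > 0\<close> by simp
  qed
  then show ?thesis using \<iota>_le[of "[]"] by simp
qed

section \<open>Lifts and arcs of the circle\<close>

definition turn :: "real \<Rightarrow> complex" where
  "turn t = cis (2 * pi * t)"

definition circle_lift :: "(real \<Rightarrow> real) \<Rightarrow> bool" where
  "circle_lift F \<longleftrightarrow> continuous_on UNIV F \<and> strict_mono F \<and> (\<forall>t. F (t + 1) = F t + 1)"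

lemma turn_in_circle [simp]: "turn t \<in> circle" "cmod (turn t) = 1"
  by (auto simp: turn_def)

lemma continuous_on_turn: "continuous_on S turn"
  unfolding turn_def by (intro continuous_intros)

lemma turn_add: "turn (s + t) = turn s * turn t"
  by (simp add: turn_def cis_mult ring_distribs)

lemma turn_add_int [simp]: "turn (t + of_int n) = turn t"
  using cis_multiple_2pi[of "of_int n"] by (simp add: turn_add) (simp add: turn_def)

lemma turn_eq_iff: "turn s = turn t \<longleftrightarrow> (\<exists>n::int. s = t + of_int n)"
proof
  assume "turn s = turn t"
  then obtain n :: int where "2 * pi * s = 2 * pi * t + 2 * pi * n"
    using sin_cos_eq_iff[of "2 * pi * s" "2 * pi * t"] by (auto simp: turn_def complex_eq_iff)
  then have "2 * pi * s = 2 * pi * (t + of_int n)" by (simp add: ring_distribs)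
  then show "\<exists>n::int. s = t + of_int n" by auto
qed auto

lemma turn_Arg: "cmod z = 1 \<Longrightarrow> turn (Arg z / (2 * pi)) = z"
  using cis_Arg[of z] by (cases "z = 0") (auto simp: turn_def sgn_eq)

lemma circle_eq_turn: "circle = range turn"
proof (intro equalityI subsetI)
  fix z :: complex assume "z \<in> circle"
  then have "z = turn (Arg z / (2 * pi))" using turn_Arg by simp
  then show "z \<in> range turn" by blast
qed auto

lemma circle_turnE:
  assumes "z \<in> circle" obtains t where "z = turn t"
  using assms unfolding circle_eq_turn by (rule rangeE)

lemma dist_turn_le: "dist (turn s) (turn t) \<le> 2 * pi * \<bar>s - t\<bar>"
proof -
  have "dist (turn s) (turn t) = cmod (cis (2 * pi * t) * (cis (2 * pi * (s - t)) - 1))"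
    by (simp add: turn_def dist_norm algebra_simps cis_mult)
  also have "\<dots> = cmod (cis (2 * pi * (s - t)) - 1)" by (simp add: norm_mult)
  also have "\<dots> \<le> \<bar>2 * pi * (s - t)\<bar>"
    using dist_exp_i_1[of "2 * pi * (s - t)"] abs_sin_x_le_abs_x[of "2 * pi * (s - t) / 2"]
    by (simp add: cis_conv_exp)
  finally show ?thesis by (simp add: abs_mult)
qed

text \<open>The angle is continued from \<open>turn t\<close> and not from \<open>1\<close>, which puts the cut of \<open>Arg\<close> opposite to
\<open>turn t\<close> and makes the angle continuous there.\<close>

lemma local_angle:
  "turn (t + Arg (z / turn t) / (2 * pi)) = z" if "z \<in> circle"
  using that turn_Arg[of "z / turn t"] by (simp add: turn_add norm_divide)
    (metis nonzero_eq_divide_eq norm_zero turn_in_circle(2) zero_neq_one mult.commute)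

lemma isCont_local_angle: "isCont (\<lambda>z. t + Arg (z / turn t) / (2 * pi)) (turn t)"
proof -
  have nz: "turn t \<noteq> 0" by (metis norm_zero turn_in_circle(2) zero_neq_one)
  have "isCont Arg (turn t / turn t)" using nz by (intro continuous_at_Arg) auto
  moreover have "isCont (\<lambda>z. z / turn t) (turn t)" using nz by (intro continuous_intros)
  ultimately have "isCont (\<lambda>z. Arg (z / turn t)) (turn t)"
    using isCont_o2 by blast
  then show ?thesis by (intro continuous_intros) auto
qed

lemma arc_neighbourhood:
  assumes "\<eta> > 0"
  shows "\<exists>V. open V \<and> turn t \<in> V \<and> V \<inter> circle \<subseteq> turn ` {t - \<eta><..<t + \<eta>}"
proof -
  define a where "a = (\<lambda>z. t + Arg (z / turn t) / (2 * pi))"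
  have nz: "turn t \<noteq> 0" by (metis norm_zero turn_in_circle(2) zero_neq_one)
  have "a (turn t) = t" using nz by (simp add: a_def)
  then obtain d where d: "d > 0" "\<And>z. dist z (turn t) < d \<Longrightarrow> dist (a z) t < \<eta>"
    using isCont_local_angle[of t] assms unfolding continuous_at_eps_delta a_def[symmetric]
    by metis
  show ?thesis
  proof (intro exI[of _ "ball (turn t) d"] conjI subsetI)
    fix z assume z: "z \<in> ball (turn t) d \<inter> circle"
    then have "a z \<in> {t - \<eta><..<t + \<eta>}" using d(2)[of z] by (auto simp: dist_real_def dist_commute)
    moreover have "turn (a z) = z" using local_angle[of z t] z by (simp add: a_def)
    ultimately show "z \<in> turn ` {t - \<eta><..<t + \<eta>}" by force
  qed (use d in auto)
qed

lemma arc_in_open: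
  assumes "open V" "turn t \<in> V"
  shows "\<exists>\<eta>>0. \<eta> < 1/8 \<and> turn ` {t - 2 * \<eta>..t + 2 * \<eta>} \<subseteq> V"
proof -
  have "isCont turn t" using continuous_on_turn[of UNIV] by (simp add: continuous_on_eq_continuous_at)
  then obtain A where A: "open A" "t \<in> A" "\<And>s. s \<in> A \<Longrightarrow> turn s \<in> V" 
    using assms by (metis continuous_at_open)
  then obtain d where d: "d > 0" "ball t d \<subseteq> A" by (meson open_contains_ball)
  define \<eta> where "\<eta> = min (d / 4) (1/16)"
  have "\<eta> > 0" "\<eta> < 1/8" "2 * \<eta> < d" using d(1) by (auto simp: \<eta>_def min_def)
  moreover have "turn ` {t - 2 * \<eta>..t + 2 * \<eta>} \<subseteq> V"
    using d(2) A(3) calculation(3) by (force simp: dist_real_def)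
  ultimately show ?thesis by blast
qed

lemma circle_lift_add_int:
  assumes "circle_lift F" shows "F (t + of_int n) = F t + of_int n"
proof -
  have nat: "F (t + of_nat n) = F t + of_nat n" for t n
  proof (induction n)
    case (Suc n)
    have "F (t + of_nat (Suc n)) = F ((t + of_nat n) + 1)" by (simp add: algebra_simps)
    also have "\<dots> = F t + of_nat (Suc n)" using assms Suc by (simp add: circle_lift_def)
    finally show ?case .
  qed simp
  show ?thesis
  proof (cases "n \<ge> 0")
    case True then show ?thesis using nat[of t "nat n"] by simp
  next
    case False then show ?thesis using nat[of "t + of_int n" "nat (- n)"] by simp
  qed
qed

lemma circle_lift_id: "circle_lift (\<lambda>t. t)"
  by (simp add: circle_lift_def strict_mono_def)

lemma circle_lift_compose: "circle_lift F \<Longrightarrow> circle_lift G \<Longrightarrow> circle_lift (\<lambda>t. F (G t))"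
  unfolding circle_lift_def
  by (auto simp: strict_mono_def intro: continuous_on_compose2[where t=UNIV])

text \<open>The pieces may be of any kind, single points included, so that the class is closed under the
removal of open intervals and under continuous maps.\<close>

definition interval_union :: "real set \<Rightarrow> bool" where
  "interval_union A \<longleftrightarrow> (\<exists>\<I>. finite \<I> \<and> (\<forall>I\<in>\<I>. connected I) \<and> A = \<Union>\<I>)"

lemma connected_Int_real: "connected I \<Longrightarrow> connected J \<Longrightarrow> connected (I \<inter> (J :: real set))"
  by (simp add: is_interval_connected_1[symmetric] is_interval_Int)

lemma interval_union_diff_open:
  assumes "interval_union A"
  shows "interval_union (A - {c<..<d})"
proof -
  obtain \<I> where I: "finite \<I>" "\<And>I. I \<in> \<I> \<Longrightarrow> connected I" "A = \<Union>\<I>"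
    using assms unfolding interval_union_def by blast
  define \<J> where "\<J> = (\<lambda>I. I \<inter> {..c}) ` \<I> \<union> (\<lambda>I. I \<inter> {d..}) ` \<I>"
  have "finite \<J>" using I by (simp add: \<J>_def)
  moreover have "\<forall>I\<in>\<J>. connected I" using I(2) by (auto simp: \<J>_def intro!: connected_Int_real)
  moreover have "A - {c<..<d} = \<Union>\<J>" using I(3) by (auto simp: \<J>_def)
  ultimately show ?thesis unfolding interval_union_def by blast
qed

lemma interval_union_diff_Union:
  assumes "interval_union A" "finite N"
  shows "interval_union (A - (\<Union>n\<in>N. {c n<..<d n}))"
  using assms(2)
proof (induction N rule: finite_induct)
  case empty then show ?case using assms by simp
next
  case (insert n N)
  have "A - (\<Union>n\<in>insert n N. {c n<..<d n}) = (A - (\<Union>n\<in>N. {c n<..<d n})) - {c n<..<d n}" by auto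
  then show ?case using interval_union_diff_open[OF insert.IH] by simp
qed

lemma interval_union_image:
  assumes "interval_union A" "continuous_on UNIV F"
  shows "interval_union (F ` A)"
proof -
  obtain \<I> where I: "finite \<I>" "\<And>I. I \<in> \<I> \<Longrightarrow> connected I" "A = \<Union>\<I>"
    using assms unfolding interval_union_def by blast
  have "finite ((`) F ` \<I>)" "\<forall>I\<in>(`) F ` \<I>. connected I" "F ` A = \<Union>((`) F ` \<I>)"
    using I assms(2) by (auto intro: connected_continuous_image continuous_on_subset)
  then show ?thesis unfolding interval_union_def by blast
qed

text \<open>The preimage of an arc under \<open>turn\<close> has infinitely many components, but only finitely many of
them meet a bounded set.\<close>

lemma interval_union_diff_arc:
  assumes A: "interval_union A" and bounded: "A \<subseteq> {p..q}"
  shows "\<exists>B. interval_union B \<and> B \<subseteq> {p..q} \<and> turn ` A - turn ` {c<..<d} = turn ` B"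
proof -
  let ?N = "{\<lfloor>p - d\<rfloor>..\<lceil>q - c\<rceil>}"
  define B where "B = A - (\<Union>n\<in>?N. {c + of_int n<..<d + of_int n})"
  have in_arc: "turn t \<in> turn ` {c<..<d} \<longleftrightarrow> (\<exists>n\<in>?N. t \<in> {c + of_int n<..<d + of_int n})" if "t \<in> A" for t
  proof
    assume "turn t \<in> turn ` {c<..<d}"
    then obtain s where "s \<in> {c<..<d}" "turn t = turn s" by blast
    then obtain n :: int where "t = s + of_int n" by (auto simp: turn_eq_iff)
    then have n: "t \<in> {c + of_int n<..<d + of_int n}" using \<open>s \<in> _\<close> by simp
    moreover have "p \<le> t" "t \<le> q" using that bounded by auto
    ultimately have "p - d < of_int n" "of_int n < q - c" by auto
    then have "n \<in> ?N" by (simp add: le_ceiling_iff floor_le_iff)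
    then show "\<exists>n\<in>?N. t \<in> {c + of_int n<..<d + of_int n}" using n by blast
  next
    assume "\<exists>n\<in>?N. t \<in> {c + of_int n<..<d + of_int n}"
    then obtain n :: int where "t \<in> {c + of_int n<..<d + of_int n}" by blast
    then have "t - of_int n \<in> {c<..<d}" by auto
    moreover have "turn t = turn (t - of_int n)" using turn_add_int[of "t - of_int n" n] by simp
    ultimately show "turn t \<in> turn ` {c<..<d}" by blast
  qed
  have "t \<in> B \<longleftrightarrow> t \<in> A \<and> turn t \<notin> turn ` {c<..<d}" for t
    unfolding B_def using in_arc[of t] by (simp only: Diff_iff UN_iff) blast
  then have "turn ` A - turn ` {c<..<d} = turn ` B"
    by (intro equalityI subsetI) (auto simp del: turn_in_circle)
  moreover have "interval_union B" unfolding B_def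
    by (rule interval_union_diff_Union[OF A]) simp
  moreover have "B \<subseteq> {p..q}" using bounded B_def by blast
  ultimately show ?thesis by blast
qed

text \<open>The interval \<open>J\<close> contains a point in a translate of the middle interval and one outside the
same translate of the double interval, hence everything between them.\<close>

lemma arc_contains_gap:
  assumes J: "connected J" and s: "s \<in> J" "turn s \<in> turn ` {t - \<eta><..<t + \<eta>}"
    and out: "\<not> turn ` J \<subseteq> turn ` {t - 2 * \<eta><..<t + 2 * \<eta>}"
  shows "turn ` {t + \<eta><..<t + 2 * \<eta>} \<subseteq> turn ` J \<or> turn ` {t - 2 * \<eta><..<t - \<eta>} \<subseteq> turn ` J"
proof -
  obtain s0 n where s0: "s0 \<in> {t - \<eta><..<t + \<eta>}" "s = s0 + of_int n"
    using s(2) by (auto simp: turn_eq_iff)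
  obtain b where b: "b \<in> J" "turn b \<notin> turn ` {t - 2 * \<eta><..<t + 2 * \<eta>}" using out by blast
  have "turn b = turn (b - of_int n)" using turn_add_int[of "b - of_int n" n] by simp
  then have "b - of_int n \<notin> {t - 2 * \<eta><..<t + 2 * \<eta>}" using b(2) by auto
  then consider "b - of_int n \<ge> t + 2 * \<eta>" | "b - of_int n \<le> t - 2 * \<eta>" by fastforce
  then show ?thesis
  proof cases
    case 1
    have "turn r \<in> turn ` J" if "r \<in> {t + \<eta><..<t + 2 * \<eta>}" for r
    proof -
      have "s \<le> r + of_int n" "r + of_int n \<le> b" using that 1 s0 by auto
      then have "r + of_int n \<in> J" using J s(1) b(1) by (meson connectedD_interval)
      then show ?thesis using turn_add_int[of r n] by (metis imageI)
    qed
    then show ?thesis by blast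
  next
    case 2
    have "turn r \<in> turn ` J" if "r \<in> {t - 2 * \<eta><..<t - \<eta>}" for r
    proof -
      have "b \<le> r + of_int n" "r + of_int n \<le> s" using that 2 s0 by auto
      then have "r + of_int n \<in> J" using J s(1) b(1) by (meson connectedD_interval)
      then show ?thesis using turn_add_int[of r n] by (metis imageI)
    qed
    then show ?thesis by blast
  qed
qed

section \<open>Universal words of a minimal system\<close>

text \<open>The maps are treated through lifts \<open>F\<close> to the line, on which arcs become intervals and
preservation of orientation becomes monotonicity.\<close>

locale minimal_circle_IFS =
  fixes k :: nat and f :: "nat \<Rightarrow> complex \<Rightarrow> complex" and F :: "nat \<Rightarrow> real \<Rightarrow> real"
  assumes k_pos: "k \<ge> 1"
    and bij_f: "\<And>i. i \<in> {1..k} \<Longrightarrow> bij_betw (f i) circle circle"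
    and cont_inv: "\<And>i. i \<in> {1..k} \<Longrightarrow> continuous_on circle (inv_into circle (f i))"
    and lift_F: "\<And>i. i \<in> {1..k} \<Longrightarrow> circle_lift (F i)"
    and f_turn: "\<And>i t. i \<in> {1..k} \<Longrightarrow> f i (turn t) = turn (F i t)"
    and forward_minimal: "IFS_minimal circle k f"
    and backward_minimal: "IFS_minimal circle k (\<lambda>i. inv_into circle (f i))"
    and cont_f: "\<And>i. i \<in> {1..k} \<Longrightarrow> continuous_on circle (f i)"
begin

definition g :: "nat \<Rightarrow> complex \<Rightarrow> complex" where
  "g i = inv_into circle (f i)"

lemma f_closed: "i \<in> {1..k} \<Longrightarrow> x \<in> circle \<Longrightarrow> f i x \<in> circle"
  using bij_f bij_betwE by blast

lemma g_closed: "i \<in> {1..k} \<Longrightarrow> x \<in> circle \<Longrightarrow> g i x \<in> circle"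
  unfolding g_def using bij_f by (metis bij_betw_imp_surj_on inv_into_into)

lemma g_f: "i \<in> {1..k} \<Longrightarrow> x \<in> circle \<Longrightarrow> g i (f i x) = x"
  unfolding g_def using bij_f bij_betw_inv_into_left by fastforce

lemma f_g: "i \<in> {1..k} \<Longrightarrow> x \<in> circle \<Longrightarrow> f i (g i x) = x"
  unfolding g_def using bij_f bij_betw_inv_into_right by fastforce

sublocale walk: finite_walk circle k g
  by unfold_locales (use k_pos g_closed in auto)

definition \<mu> :: "complex set \<Rightarrow> real" where
  "\<mu> A = walk.mean (indicator A)"

lemma bounded_indicator: "bounded_fun_on X (indicator A)"
  unfolding bounded_fun_on_def by (auto simp: indicator_def intro!: exI[of _ 1])

lemma \<mu>_mono: "A \<subseteq> B \<Longrightarrow> \<mu> A \<le> \<mu> B"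
  unfolding \<mu>_def by (rule walk.mean_mono) (auto intro: bounded_indicator simp: indicator_def)

lemma \<mu>_nonneg: "0 \<le> \<mu> A"
  unfolding \<mu>_def by (rule walk.mean_nonneg) (auto intro: bounded_indicator)

lemma \<mu>_superharmonic:
  assumes "A \<subseteq> circle"
  shows "(\<Sum>i=1..k. \<mu> (f i ` A)) \<le> k * \<mu> A"
proof -
  have "\<mu> (f i ` A) \<le> walk.mean (\<lambda>x. indicator A (g i x))" if i: "i \<in> {1..k}" for i
    unfolding \<mu>_def
  proof (rule walk.mean_mono)
    show "bounded_fun_on circle (\<lambda>x. indicator A (g i x) :: real)"
      by (rule walk.bounded_fun_on_shift[OF i bounded_indicator])
    show "indicator (f i ` A) x \<le> (indicator A (g i x) :: real)" for x
      using assms g_f[OF i] by (auto simp: indicator_def subset_iff)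
  qed (rule bounded_indicator)
  then have "(\<Sum>i=1..k. \<mu> (f i ` A)) \<le> (\<Sum>i=1..k. walk.mean (\<lambda>x. indicator A (g i x)))"
    by (intro sum_mono) auto
  also have "\<dots> \<le> k * \<mu> A"
    unfolding \<mu>_def by (rule walk.mean_superharmonic[OF bounded_indicator])
  finally show ?thesis .
qed

lemma forward_hitting:
  assumes "open V" "V \<inter> circle \<noteq> {}"
  shows "\<exists>n. \<forall>x\<in>circle. \<exists>s\<in>lists {1..k}. length s \<le> n \<and> fold f s x \<in> V"
  by (rule uniform_hitting_time) (use assms cont_f f_closed forward_minimal in auto)

lemma backward_hitting:
  assumes "open V" "V \<inter> circle \<noteq> {}"
  shows "\<exists>n. \<forall>x\<in>circle. \<exists>s\<in>lists {1..k}. length s \<le> n \<and> fold g s x \<in> V"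
  by (rule uniform_hitting_time)
    (use assms cont_inv g_closed backward_minimal in \<open>auto simp: g_def[abs_def]\<close>)

lemma backward_hitting_arc:
  assumes "a < b"
  shows "\<exists>n. \<forall>x\<in>circle. \<exists>s\<in>lists {1..k}. length s \<le> n \<and> fold g s x \<in> turn ` {a<..<b}"
proof -
  define \<eta> where "\<eta> = (b - a) / 2"
  have \<eta>: "(a + b) / 2 - \<eta> = a" "(a + b) / 2 + \<eta> = b" "\<eta> > 0"
    using assms by (auto simp: \<eta>_def field_simps)
  obtain V where V: "open V" "turn ((a + b) / 2) \<in> V" "V \<inter> circle \<subseteq> turn ` {a<..<b}"
    using arc_neighbourhood[OF \<eta>(3), of "(a + b) / 2"] \<eta> by auto
  have "V \<inter> circle \<noteq> {}" using V(2) turn_in_circle(1) by blast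
  then obtain n where n: "\<forall>x\<in>circle. \<exists>s\<in>lists {1..k}. length s \<le> n \<and> fold g s x \<in> V"
    using backward_hitting[OF V(1)] by blast
  have "\<exists>s\<in>lists {1..k}. length s \<le> n \<and> fold g s x \<in> turn ` {a<..<b}" if "x \<in> circle" for x
    using n that V(3) walk.fold_closed by blast
  then show ?thesis by blast
qed

lemma \<mu>_arc_pos:
  assumes "a < b" shows "\<mu> (turn ` {a<..<b}) > 0"
proof -
  obtain n where "\<forall>x\<in>circle. \<exists>s\<in>lists {1..k}. length s \<le> n \<and> fold g s x \<in> turn ` {a<..<b}"
    using backward_hitting_arc[OF assms] by blast
  then have "(1 / (2 * k)) ^ n \<le> \<mu> (turn ` {a<..<b})"
    unfolding \<mu>_def using walk.mean_pos_of_reachable by blast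
  moreover have "0 < (1 / real (2 * k)) ^ n" using k_pos by simp
  ultimately show ?thesis by linarith
qed

lemma fold_f_closed: "v \<in> lists {1..k} \<Longrightarrow> x \<in> circle \<Longrightarrow> fold f v x \<in> circle"
  using fold_in_closed[of k circle f] f_closed by blast

lemma word_lift: "v \<in> lists {1..k} \<Longrightarrow> circle_lift (fold F v)"
proof (induction v)
  case Nil then show ?case using circle_lift_id by (simp add: id_def)
next
  case (Cons i v)
  then have "circle_lift (fold F v)" "circle_lift (F i)" using lift_F by auto
  then have "circle_lift (\<lambda>t. fold F v (F i t))" by (rule circle_lift_compose)
  then show ?case by (simp add: o_def)
qed

lemma word_turn: "v \<in> lists {1..k} \<Longrightarrow> fold f v (turn t) = turn (fold F v t)"
  by (induction v arbitrary: t) (auto simp: f_turn)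

text \<open>The function \<open>v \<mapsto> \<mu> (fold f v ` A)\<close> is superharmonic on the tree of words. If it were at least
\<open>\<delta>\<close> at all the words that take \<open>x\<close> to \<open>V\<close>, which are within bounded distance from
every word, it would be at least \<open>\<delta>\<close> at the empty word.\<close>

lemma word_steers_point:
  assumes A: "A \<subseteq> circle" and x: "x \<in> circle" and V: "open V" "V \<inter> circle \<noteq> {}" and less: "\<mu> A < \<delta>"
  shows "\<exists>v\<in>lists {1..k}. fold f v x \<in> V \<and> \<mu> (fold f v ` A) < \<delta>"
proof (rule ccontr)
  assume contra: "\<not> ?thesis"
  obtain n where n: "\<forall>x\<in>circle. \<exists>s\<in>lists {1..k}. length s \<le> n \<and> fold f s x \<in> V"
    using forward_hitting[OF V] by blast
  have "\<delta> \<le> \<mu> (fold f [] ` A)"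
  proof (rule tree_minimum_principle[OF k_pos, where G="\<lambda>v. \<mu> (fold f v ` A)"])
    fix v assume v: "v \<in> lists {1..k}"
    show "0 \<le> \<mu> (fold f v ` A)" by (rule \<mu>_nonneg)
    have "fold f v ` A \<subseteq> circle" using fold_f_closed[OF v] A by blast
    then have "(\<Sum>i=1..k. \<mu> (f i ` fold f v ` A)) \<le> k * \<mu> (fold f v ` A)" by (rule \<mu>_superharmonic)
    then show "(\<Sum>i=1..k. \<mu> (fold f (v @ [i]) ` A)) \<le> k * \<mu> (fold f v ` A)"
      by (simp add: image_comp o_def)
    obtain u where u: "u \<in> lists {1..k}" "length u \<le> n" "fold f u (fold f v x) \<in> V"
      using n fold_f_closed[OF v x] by blast
    then have "v @ u \<in> lists {1..k}" "fold f (v @ u) x \<in> V" using v by simp_all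
    then have "\<delta> \<le> \<mu> (fold f (v @ u) ` A)" using contra not_less by blast
    then show "\<exists>u\<in>lists {1..k}. length u \<le> n \<and> \<delta> \<le> \<mu> (fold f (v @ u) ` A)" using u by blast
  qed
  then show False using less by simp
qed

text \<open>One interval \<open>I\<close> is treated at a time. A word that takes a point of \<open>I\<close> to the middle part of the
target arc, and keeps the mass of all the arcs below \<open>\<delta>\<close>, takes the whole of \<open>I\<close> into the target
arc, since otherwise the image of \<open>I\<close> would contain one of the gaps. The images of the other
intervals have small mass and are fewer.\<close>

lemma light_arcs_swallowed:
  assumes "\<eta> > 0"
    and gaps: "\<delta> \<le> \<mu> (turn ` {t + \<eta><..<t + 2 * \<eta>})" "\<delta> \<le> \<mu> (turn ` {t - 2 * \<eta><..<t - \<eta>})"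
  shows "(\<forall>I\<in>set Js. connected I) \<Longrightarrow> \<mu> (turn ` \<Union>(set Js)) < \<delta> \<Longrightarrow>
    \<exists>v\<in>lists {1..k}. \<forall>x\<in>turn ` \<Union>(set Js). \<exists>j\<le>length v.
      fold f (take j v) x \<in> turn ` {t - 2 * \<eta><..<t + 2 * \<eta>}"
proof (induction "length Js" arbitrary: Js)
  case 0
  then show ?case by (intro bexI[of _ "[]"]) auto
next
  case (Suc n)
  let ?U = "turn ` {t - 2 * \<eta><..<t + 2 * \<eta>}"
  obtain I Js' where Js: "Js = I # Js'" "length Js' = n" using Suc.hyps(2) by (cases Js) auto
  let ?A = "turn ` \<Union>(set Js)"
  show ?case
  proof (cases "I = {}")
    case True
    then show ?thesis using Suc.hyps(1)[of Js'] Suc.prems Js by simp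
  next
    case False
    then obtain s where s: "s \<in> I" by blast
    obtain V where V: "open V" "turn t \<in> V" "V \<inter> circle \<subseteq> turn ` {t - \<eta><..<t + \<eta>}"
      using arc_neighbourhood[OF assms(1)] by blast
    have VC: "V \<inter> circle \<noteq> {}" using V(2) turn_in_circle(1) by blast
    have "?A \<subseteq> circle" by auto
    from word_steers_point[OF this turn_in_circle(1) V(1) VC Suc.prems(2)]
    obtain v where v: "v \<in> lists {1..k}" "fold f v (turn s) \<in> V" "\<mu> (fold f v ` ?A) < \<delta>"
      by blast
    have image: "fold f v ` turn ` S = turn ` fold F v ` S" for S
      using word_turn[OF v(1)] by (auto simp: image_iff)
    have lift: "continuous_on S (fold F v)" for S
      using word_lift[OF v(1)] by (auto simp: circle_lift_def intro: continuous_on_subset)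
    have "fold f v ` turn ` I \<subseteq> ?U"
    proof (rule ccontr)
      assume out: "\<not> fold f v ` turn ` I \<subseteq> ?U"
      have "turn (fold F v s) \<in> turn ` {t - \<eta><..<t + \<eta>}"
        using v(2) V(3) word_turn[OF v(1)] turn_in_circle(1) by (metis IntI subsetD)
      moreover have "connected (fold F v ` I)"
        using Suc.prems(1) Js lift by (auto intro: connected_continuous_image)
      ultimately have "turn ` {t + \<eta><..<t + 2 * \<eta>} \<subseteq> fold f v ` turn ` I \<or>
          turn ` {t - 2 * \<eta><..<t - \<eta>} \<subseteq> fold f v ` turn ` I"
        using arc_contains_gap[of "fold F v ` I" "fold F v s" t \<eta>] s out unfolding image by blast
      then have "\<delta> \<le> \<mu> (fold f v ` turn ` I)" using gaps \<mu>_mono order_trans by blast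
      also have "\<dots> \<le> \<mu> (fold f v ` ?A)" by (rule \<mu>_mono) (use Js in auto)
      finally show False using v(3) by simp
    qed
    moreover
    let ?Js = "map (\<lambda>J. fold F v ` J) Js'"
    have un: "turn ` \<Union>(set ?Js) = fold f v ` turn ` \<Union>(set Js')"
      unfolding image by auto
    have "\<mu> (turn ` \<Union>(set ?Js)) \<le> \<mu> (fold f v ` ?A)"
      unfolding un by (rule \<mu>_mono) (use Js in auto)
    moreover have "\<forall>J\<in>set ?Js. connected J"
      using Suc.prems(1) Js lift by (auto intro: connected_continuous_image)
    ultimately obtain w where w: "w \<in> lists {1..k}"
      "\<forall>x\<in>turn ` \<Union>(set ?Js). \<exists>j\<le>length w. fold f (take j w) x \<in> ?U"
      using Suc.hyps(1)[of ?Js] Js v(3) by force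
    have "\<exists>j\<le>length (v @ w). fold f (take j (v @ w)) x \<in> ?U" if "x \<in> ?A" for x
    proof (cases "x \<in> turn ` I")
      case True
      then have "fold f (take (length v) (v @ w)) x \<in> ?U"
        using \<open>fold f v ` turn ` I \<subseteq> ?U\<close> by auto
      then show ?thesis by (metis length_append le_add1)
    next
      case False
      then have "x \<in> turn ` \<Union>(set Js')" using that Js by auto
      then have "fold f v x \<in> turn ` \<Union>(set ?Js)" unfolding un by blast
      then obtain j where j: "j \<le> length w" "fold f (take j w) (fold f v x) \<in> ?U" using w(2) by blast
      then have "fold f (take (length v + j) (v @ w)) x \<in> ?U" by simp
      then show ?thesis using j(1) by (intro exI[of _ "length v + j"]) simp
    qed
    moreover have "v @ w \<in> lists {1..k}" using v(1) w(1) by simp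
    ultimately show ?thesis by blast
  qed
qed

lemma avoiding_is_interval_union:
  assumes "r \<in> lists {1..k}"
  shows "\<exists>A p q. interval_union A \<and> A \<subseteq> {p..q} \<and> avoiding circle g (turn ` {c<..<d}) r = turn ` A"
  using assms
proof (induction r)
  case Nil
  have "circle \<subseteq> turn ` {0..1}"
  proof
    fix z assume "z \<in> circle"
    then obtain t where "z = turn t" using circle_eq_turn by blast
    moreover have "turn t = turn (frac t)"
      using turn_add_int[of "frac t" "\<lfloor>t\<rfloor>"] by (simp add: frac_def)
    moreover have "frac t \<in> {0..1}" using frac_ge_0[of t] frac_lt_1[of t] by simp
    ultimately show "z \<in> turn ` {0..1}" by blast
  qed
  then have "avoiding circle g (turn ` {c<..<d}) [] = turn ` {0..1}"
    by (auto simp: avoiding_Nil)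
  moreover have "interval_union {0..1}"
    unfolding interval_union_def by (intro exI[of _ "{{0..1}}"]) auto
  ultimately show ?case by blast
next
  case (Cons i r)
  let ?U = "turn ` {c<..<d}"
  have i: "i \<in> {1..k}" using Cons.hyps by simp
  obtain A p q where A: "interval_union A" "A \<subseteq> {p..q}" "avoiding circle g ?U r = turn ` A"
    using Cons.IH by blast
  have lift: "circle_lift (F i)" by (rule lift_F[OF i])
  have "avoiding circle g ?U (i # r) = f i ` avoiding circle g ?U r - ?U"
  proof (intro equalityI subsetI)
    fix x assume x: "x \<in> avoiding circle g ?U (i # r)"
    then have xc: "x \<in> circle" by (simp add: avoiding_def)
    then have "x \<notin> ?U" "g i x \<in> avoiding circle g ?U r"
      using x avoiding_Cons[of x circle g i ?U r] g_closed[OF i] by blast+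
    then show "x \<in> f i ` avoiding circle g ?U r - ?U"
      using f_g[OF i xc] by (metis Diff_iff image_eqI)
  next
    fix x assume x: "x \<in> f i ` avoiding circle g ?U r - ?U"
    then obtain y where y: "x = f i y" "y \<in> avoiding circle g ?U r" by blast
    then have "y \<in> circle" by (simp add: avoiding_def)
    then show "x \<in> avoiding circle g ?U (i # r)"
      using x y avoiding_Cons[of x circle g i ?U r] g_f[OF i] f_closed[OF i] by simp
  qed
  also have "f i ` avoiding circle g ?U r = turn ` F i ` A"
    unfolding A(3) using f_turn[OF i] by (auto simp: image_iff)
  finally have eq: "avoiding circle g ?U (i # r) = turn ` F i ` A - ?U" .
  have "F i ` A \<subseteq> {F i p..F i q}"
    using A(2) lift by (auto simp: circle_lift_def strict_mono_less_eq)
  moreover have "interval_union (F i ` A)"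
    using interval_union_image[OF A(1)] lift by (simp add: circle_lift_def)
  ultimately show ?case using interval_union_diff_arc eq by metis
qed

text \<open>The backward path that starts from the endpoint of the orbit of \<open>y\<close> retraces this orbit.\<close>

lemma survivors_avoid:
  assumes "w \<in> lists {1..k}" "y \<in> circle" "\<forall>j\<le>length w. fold f (take j w) y \<notin> U"
  shows "fold f w y \<in> avoiding circle g U (rev w)"
  using assms(1,3)
proof (induction w rule: rev_induct)
  case Nil then show ?case using assms(2) by (simp add: avoiding_Nil)
next
  case (snoc i w)
  have i: "i \<in> {1..k}" and w: "w \<in> lists {1..k}" using snoc.prems by auto
  have "\<forall>j\<le>length w. fold f (take j w) y \<notin> U"
  proof (intro allI impI)
    fix j assume "j \<le> length w"
    then show "fold f (take j w) y \<notin> U" using snoc.prems(2)[rule_format, of j] by simp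
  qed
  then have z: "fold f w y \<in> avoiding circle g U (rev w)" using snoc.IH[OF w] by blast
  have zc: "fold f w y \<in> circle" by (rule fold_f_closed[OF w assms(2)])
  have "f i (fold f w y) \<notin> U" using snoc.prems(2)[rule_format, of "Suc (length w)"] by simp
  then show ?case
    using avoiding_Cons[of "f i (fold f w y)" circle g i U "rev w"] z zc g_f[OF i] f_closed[OF i] by simp
qed

text \<open>The word consists of a first part whose survivors form finitely many arcs of small mass, and a
second part that takes these arcs into the target one after the other.\<close>

theorem universal_word:
  assumes "open W" "W \<inter> circle \<noteq> {}"
  shows "\<exists>w\<in>lists {1..k}. \<forall>x\<in>circle. \<exists>j\<le>length w. fold f (take j w) x \<in> W"
proof -
  obtain t where "turn t \<in> W" using assms(2) circle_eq_turn by auto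
  then obtain \<eta> where \<eta>: "\<eta> > 0" "turn ` {t - 2 * \<eta>..t + 2 * \<eta>} \<subseteq> W"
    using arc_in_open[OF assms(1)] by blast
  define U where "U = turn ` {t - 2 * \<eta><..<t + 2 * \<eta>}"
  have UW: "U \<subseteq> W" using \<eta>(2) unfolding U_def by (force)
  define \<delta> where "\<delta> = min (\<mu> (turn ` {t + \<eta><..<t + 2 * \<eta>})) (\<mu> (turn ` {t - 2 * \<eta><..<t - \<eta>}))"
  have "\<delta> > 0" unfolding \<delta>_def using \<mu>_arc_pos \<eta>(1) by simp
  obtain n where n: "\<forall>x\<in>circle. \<exists>s\<in>lists {1..k}. length s \<le> n \<and> fold g s x \<in> U"
    using backward_hitting_arc[of "t - 2 * \<eta>" "t + 2 * \<eta>"] \<eta>(1) U_def by auto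
  then obtain r where r: "r \<in> lists {1..k}" "\<mu> (avoiding circle g U r) < \<delta>"
    using walk.avoiding_small_mean[of n U \<delta>] \<open>\<delta> > 0\<close> unfolding \<mu>_def by blast
  obtain A where A: "interval_union A" "avoiding circle g U r = turn ` A"
    using avoiding_is_interval_union[OF r(1)] U_def by metis
  then obtain \<I> where I: "finite \<I>" "\<forall>I\<in>\<I>. connected I" "A = \<Union>\<I>"
    unfolding interval_union_def by blast
  obtain Js where Js: "set Js = \<I>" using finite_list[OF I(1)] by blast
  obtain v where v: "v \<in> lists {1..k}"
    "\<forall>x\<in>turn ` A. \<exists>j\<le>length v. fold f (take j v) x \<in> U"
    using light_arcs_swallowed[OF \<eta>(1), of \<delta> t Js] I(2) Js r(2) A(2) I(3)
    unfolding U_def \<delta>_def by auto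
  have "\<exists>j\<le>length (rev r @ v). fold f (take j (rev r @ v)) x \<in> W" if x: "x \<in> circle" for x
  proof (cases "\<exists>j\<le>length (rev r). fold f (take j (rev r)) x \<in> U")
    case True
    then obtain j where j: "j \<le> length (rev r)" "fold f (take j (rev r)) x \<in> U" by blast
    then have "fold f (take j (rev r @ v)) x \<in> W" using UW by auto
    then show ?thesis using j(1) by (intro exI[of _ j]) simp
  next
    case False
    moreover have "rev r \<in> lists {1..k}" using r(1) by auto
    ultimately have "fold f (rev r) x \<in> turn ` A"
      using survivors_avoid[of "rev r" x U] x A(2) by simp
    then obtain j where j: "j \<le> length v" "fold f (take j v) (fold f (rev r) x) \<in> U" using v(2) by blast
    then have "fold f (take (length r + j) (rev r @ v)) x \<in> W" using UW by auto
    then show ?thesis using j(1) by (intro exI[of _ "length r + j"]) simp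
  qed
  moreover have "rev r @ v \<in> lists {1..k}" using r(1) v(1) by auto
  ultimately show ?thesis by blast
qed

end

section \<open>Fibre orbits along disjunctive sequences\<close>

definition occurs_at :: "nat list \<Rightarrow> (nat \<Rightarrow> nat) \<Rightarrow> nat \<Rightarrow> bool" where
  "occurs_at w \<omega> n \<longleftrightarrow> (\<forall>j<length w. \<omega> (n + j) = w ! j)"

text \<open>The set \<open>\<Omega>\<close> of the theorem, common to all systems of \<open>k\<close> maps and all probabilities.\<close>

definition disjunctive_seqs :: "nat \<Rightarrow> (nat \<Rightarrow> nat) set" where
  "disjunctive_seqs k = {\<omega> \<in> symbol_seqs k. \<forall>w\<in>lists {1..k}. \<exists>n. occurs_at w \<omega> n}"

lemma fiber_iterate_occurs:
  assumes "occurs_at w \<omega> n" "j \<le> length w"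
  shows "fiber_iterate f \<omega> (n + j) x = fold f (take j w) (fiber_iterate f \<omega> n x)"
  using assms(2)
proof (induction j)
  case 0 then show ?case by simp
next
  case (Suc j)
  have "\<omega> (n + j) = w ! j" using assms(1) Suc.prems by (simp add: occurs_at_def)
  then show ?case using Suc by (simp add: take_Suc_conv_app_nth)
qed

lemma occurs_at_Cons: "occurs_at (i # w) \<omega> n \<longleftrightarrow> \<omega> n = i \<and> occurs_at w \<omega> (Suc n)"
  unfolding occurs_at_def by (auto simp: All_less_Suc2)

text \<open>The universal word is preceded by an arbitrary letter because the fibre orbit of \<open>x\<close> does not
contain \<open>x\<close> itself: the visit must take place at a positive time.\<close>

lemma (in minimal_circle_IFS) dense_fiber_orbit:
  assumes \<omega>: "\<omega> \<in> disjunctive_seqs k" and x: "x \<in> circle"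
  shows "closure (fiber_orbit f \<omega> x) = circle"
proof
  have sym: "\<omega> n \<in> {1..k}" for n using \<omega> by (simp add: disjunctive_seqs_def symbol_seqs_def)
  have iter: "fiber_iterate f \<omega> n x \<in> circle" for n
    by (induction n) (use x f_closed sym in auto)
  then have "fiber_orbit f \<omega> x \<subseteq> circle" unfolding fiber_orbit_def by blast
  then show "closure (fiber_orbit f \<omega> x) \<subseteq> circle" by (intro closure_minimal) auto
  show "circle \<subseteq> closure (fiber_orbit f \<omega> x)"
  proof
    fix z assume z: "z \<in> circle"
    have "\<exists>y\<in>fiber_orbit f \<omega> x. dist y z < e" if "e > 0" for e
    proof -
      have "ball z e \<inter> circle \<noteq> {}" using z that centre_in_ball by blast
      then obtain w where w: "w \<in> lists {1..k}"
        "\<forall>x\<in>circle. \<exists>j\<le>length w. fold f (take j w) x \<in> ball z e"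
        using universal_word[OF open_ball] by blast
      have "1 # w \<in> lists {1..k}" using w(1) k_pos by simp
      then obtain n where "occurs_at (1 # w) \<omega> n" using \<omega> unfolding disjunctive_seqs_def by blast
      then have occ: "occurs_at w \<omega> (Suc n)" by (simp add: occurs_at_Cons)
      obtain j where j: "j \<le> length w" "fold f (take j w) (fiber_iterate f \<omega> (Suc n) x) \<in> ball z e"
        using w(2) iter by blast
      have "fiber_iterate f \<omega> (Suc n + j) x \<in> ball z e"
        using fiber_iterate_occurs[OF occ j(1), of f x] j(2) by simp
      moreover have "fiber_iterate f \<omega> (Suc n + j) x \<in> fiber_orbit f \<omega> x"
        unfolding fiber_orbit_def by force
      ultimately show ?thesis by (auto simp: dist_commute)
    qed
    then show "z \<in> closure (fiber_orbit f \<omega> x)" by (simp add: closure_approachable)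
  qed
qed

lemma open_occurs_at: "open {\<omega>. occurs_at w \<omega> n}"
proof -
  have "{\<omega>. occurs_at w \<omega> n} = (\<Inter>j\<in>{..<length w}. (\<lambda>\<omega>. \<omega> (n + j)) -` {w ! j})"
    by (auto simp: occurs_at_def)
  moreover have "open ((\<lambda>\<omega> :: nat \<Rightarrow> nat. \<omega> (n + j)) -` {w ! j})" for j
    by (rule open_vimage) (auto intro: Topological_Spaces.open_discrete continuous_on_product_coordinates)
  ultimately show ?thesis by auto
qed

lemma funpow_shift: "(shift ^^ n) \<omega> j = \<omega> (n + j)"
  by (induction n arbitrary: j) (auto simp: shift_def)

lemma shift_dense_orbit_imp_disjunctive:
  assumes "k \<ge> 1" "\<omega> \<in> symbol_seqs k" "shift_dense_orbit k \<omega>"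
  shows "\<omega> \<in> disjunctive_seqs k"
  unfolding disjunctive_seqs_def
proof (intro CollectI conjI ballI)
  fix w assume w: "w \<in> lists {1..k}"
  define a where "a = (\<lambda>j. if j < length w then w ! j else 1)"
  have "w ! j \<in> {1..k}" if "j < length w" for j using w that nth_mem by auto
  then have "a \<in> symbol_seqs k" using assms(1) by (auto simp: symbol_seqs_def a_def)
  then have "a \<in> closure {(shift ^^ n) \<omega> | n. True}"
    using assms(3) by (simp add: shift_dense_orbit_def)
  moreover have "a \<in> {\<omega>. occurs_at w \<omega> 0}" by (simp add: occurs_at_def a_def)
  ultimately have "{\<omega>. occurs_at w \<omega> 0} \<inter> {(shift ^^ n) \<omega> | n. True} \<noteq> {}"
    using open_Int_closure_eq_empty[OF open_occurs_at[of w 0], of "{(shift ^^ n) \<omega> | n. True}"]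
    by blast
  then obtain b where b: "b \<in> {(shift ^^ n) \<omega> | n. True}" "b \<in> {\<omega>. occurs_at w \<omega> 0}"
    by blast
  then obtain n where "b = (shift ^^ n) \<omega>" by blast
  then have "occurs_at w \<omega> n" using b(2) by (simp add: occurs_at_def funpow_shift)
  then show "\<exists>n. occurs_at w \<omega> n" by blast
qed (use assms in auto)

section \<open>Disjunctive sequences have full probability\<close>

text \<open>Ellipticity means that each letter has conditional probability at least \<open>p\<close>, whatever the past.\<close>

locale elliptic_symbol_process = prob_space P for P :: "(nat \<Rightarrow> nat) measure" +
  fixes k :: nat and p :: real
  assumes sets_P: "sets P = sets (restrict_space borel (symbol_seqs k))"
    and p_pos: "0 < p" and p_le_1: "p \<le> 1"
    and transition: "transition_prob_ge k P p"
begin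

lemma space_P: "space P = symbol_seqs k"
  using sets_eq_imp_space_eq[OF sets_P] by (simp add: space_restrict_space)

lemma open_in_sets:
  assumes "open V" shows "V \<inter> symbol_seqs k \<in> sets P"
proof -
  have "symbol_seqs k \<inter> V \<in> (\<inter>) (symbol_seqs k) ` sets borel"
    using borel_open[OF assms] by (rule imageI)
  then show ?thesis by (simp only: sets_P sets_restrict_space Int_commute)
qed

lemma occurs_in_sets: "{\<omega> \<in> symbol_seqs k. occurs_at w \<omega> n} \<in> sets P"
  using open_in_sets[OF open_occurs_at[of w n]]
  by (simp add: Int_def conj_commute)

definition cylinder :: "(nat \<Rightarrow> nat) \<Rightarrow> nat \<Rightarrow> (nat \<Rightarrow> nat) set" where
  "cylinder a N = {\<omega> \<in> symbol_seqs k. \<forall>j<N. \<omega> j = a j}"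

definition determined_by :: "nat \<Rightarrow> (nat \<Rightarrow> nat) set \<Rightarrow> bool" where
  "determined_by N E \<longleftrightarrow> E \<subseteq> symbol_seqs k \<and> (\<forall>\<omega>\<in>E. cylinder \<omega> N \<subseteq> E)"

lemma cylinder_sets: "cylinder a N \<in> sets P"
proof -
  have "cylinder a N = {\<omega> \<in> symbol_seqs k. occurs_at (map a [0..<N]) \<omega> 0}"
    by (auto simp: cylinder_def occurs_at_def)
  then show ?thesis using occurs_in_sets by simp
qed

lemma cylinder_step:
  assumes "a \<in> symbol_seqs k" "i \<in> {1..k}"
  shows "p * prob (cylinder a N) \<le> prob {\<omega> \<in> cylinder a N. \<omega> N = i}"
proof (cases "prob (cylinder a N) > 0")
  case True
  have eq: "{\<omega> \<in> space P. \<forall>j<N. \<omega> j = a j} = cylinder a N"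
    "{\<omega> \<in> space P. \<omega> N = i \<and> (\<forall>j<N. \<omega> j = a j)} = {\<omega> \<in> cylinder a N. \<omega> N = i}"
    by (auto simp: space_P cylinder_def)
  have "p \<le> prob {\<omega> \<in> cylinder a N. \<omega> N = i} / prob (cylinder a N)"
    using transition[unfolded transition_prob_ge_def, rule_format, OF assms(2,1), of N] True
    unfolding cond_prob_def eq by simp
  then show ?thesis using True by (simp add: field_simps)
next
  case False
  then have "prob (cylinder a N) = 0" using measure_nonneg[of P "cylinder a N"] by linarith
  then show ?thesis by simp
qed

text \<open>An event that depends on the first \<open>N\<close> letters is a finite disjoint union of cylinders, and the
bound on conditional probabilities holds on each of them.\<close>

lemma determined_step:
  assumes E: "determined_by N E" and i: "i \<in> {1..k}"
  shows "E \<in> sets P" "p * prob E \<le> prob {\<omega> \<in> E. \<omega> N = i}"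
proof -
  define R where "R = (\<lambda>\<omega>. restrict \<omega> {..<N}) ` E"
  have "R \<subseteq> PiE {..<N} (\<lambda>_. {1..k})"
  proof
    fix r assume "r \<in> R"
    then obtain \<omega> where \<omega>: "\<omega> \<in> E" "r = restrict \<omega> {..<N}" unfolding R_def by blast
    then have "\<omega> \<in> symbol_seqs k" using E by (auto simp: determined_by_def)
    then show "r \<in> PiE {..<N} (\<lambda>_. {1..k})"
      unfolding \<omega>(2) restrict_PiE_iff symbol_seqs_def by blast
  qed
  then have finR: "finite R" by (rule finite_subset) (auto intro: finite_PiE)
  have rep: "\<exists>\<omega>\<in>E. cylinder r N = cylinder \<omega> N" if "r \<in> R" for r
  proof -
    obtain \<omega> where "\<omega> \<in> E" "r = restrict \<omega> {..<N}" using \<open>r \<in> R\<close> unfolding R_def by blast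
    then show ?thesis by (intro bexI[of _ \<omega>]) (auto simp: cylinder_def)
  qed
  have EU: "E = (\<Union>r\<in>R. cylinder r N)"
  proof (intro equalityI subsetI)
    fix \<omega> assume "\<omega> \<in> E"
    moreover from this have "\<omega> \<in> cylinder (restrict \<omega> {..<N}) N"
      using E by (auto simp: cylinder_def determined_by_def)
    ultimately show "\<omega> \<in> (\<Union>r\<in>R. cylinder r N)" unfolding R_def by blast
  next
    fix \<omega> assume "\<omega> \<in> (\<Union>r\<in>R. cylinder r N)"
    then show "\<omega> \<in> E" using rep E unfolding determined_by_def by blast
  qed
  then show "E \<in> sets P" using finR cylinder_sets by auto
  have disj: "disjoint_family_on (\<lambda>r. cylinder r N) R"
    unfolding disjoint_family_on_def
  proof (intro ballI impI)
    fix r r' assume r: "r \<in> R" "r' \<in> R" "r \<noteq> r'"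
    then obtain j where "r j \<noteq> r' j" by blast
    moreover have "r j = r' j" if "\<not> j < N" using r(1,2) that by (auto simp: R_def)
    ultimately show "cylinder r N \<inter> cylinder r' N = {}" by (fastforce simp: cylinder_def)
  qed
  have step_sets: "{\<omega> \<in> cylinder r N. \<omega> N = i} \<in> sets P" for r
  proof -
    have "{\<omega> \<in> cylinder r N. \<omega> N = i} = cylinder (r(N := i)) (Suc N)"
      by (auto simp: cylinder_def less_Suc_eq)
    then show ?thesis using cylinder_sets by simp
  qed
  have "p * prob E = (\<Sum>r\<in>R. p * prob (cylinder r N))"
    unfolding EU by (subst finite_measure_finite_Union[OF finR _ disj])
      (use cylinder_sets in \<open>auto simp: sum_distrib_left\<close>)
  also have "\<dots> \<le> (\<Sum>r\<in>R. prob {\<omega> \<in> cylinder r N. \<omega> N = i})"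
  proof (rule sum_mono)
    fix r assume "r \<in> R"
    then obtain \<omega> where "\<omega> \<in> E" and eq: "cylinder r N = cylinder \<omega> N" using rep by blast
    then have "\<omega> \<in> symbol_seqs k" using E by (auto simp: determined_by_def)
    then show "p * prob (cylinder r N) \<le> prob {\<omega> \<in> cylinder r N. \<omega> N = i}"
      unfolding eq using cylinder_step i by blast
  qed
  also have "\<dots> = prob (\<Union>r\<in>R. {\<omega> \<in> cylinder r N. \<omega> N = i})"
  proof (rule finite_measure_finite_Union[symmetric, OF finR])
    show "disjoint_family_on (\<lambda>r. {\<omega> \<in> cylinder r N. \<omega> N = i}) R"
      using disj unfolding disjoint_family_on_def by blast
  qed (use step_sets in auto)
  also have "(\<Union>r\<in>R. {\<omega> \<in> cylinder r N. \<omega> N = i}) = {\<omega> \<in> E. \<omega> N = i}"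
    using EU by blast
  finally show "p * prob E \<le> prob {\<omega> \<in> E. \<omega> N = i}" .
qed

lemma determined_word:
  assumes "determined_by N E" "w \<in> lists {1..k}"
  shows "determined_by (N + length w) {\<omega> \<in> E. occurs_at w \<omega> N}"
    "p ^ length w * prob E \<le> prob {\<omega> \<in> E. occurs_at w \<omega> N}"
proof -
  show det: "determined_by (N + length w) {\<omega> \<in> E. occurs_at w \<omega> N}" for w
    unfolding determined_by_def
  proof (intro conjI ballI subsetI)
    show "\<omega> \<in> symbol_seqs k" if "\<omega> \<in> {\<omega> \<in> E. occurs_at w \<omega> N}" for \<omega>
      using assms(1) that by (auto simp: determined_by_def)
    fix \<omega> \<omega>' assume a: "\<omega> \<in> {\<omega> \<in> E. occurs_at w \<omega> N}" "\<omega>' \<in> cylinder \<omega> (N + length w)"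
    then have "\<omega>' \<in> cylinder \<omega> N" by (auto simp: cylinder_def)
    then have "\<omega>' \<in> E" using assms(1) a(1) by (auto simp: determined_by_def)
    moreover have "occurs_at w \<omega>' N" using a by (auto simp: occurs_at_def cylinder_def)
    ultimately show "\<omega>' \<in> {\<omega> \<in> E. occurs_at w \<omega> N}" by simp
  qed
  show "p ^ length w * prob E \<le> prob {\<omega> \<in> E. occurs_at w \<omega> N}"
    using assms(2)
  proof (induction w rule: rev_induct)
    case Nil then show ?case by (simp add: occurs_at_def)
  next
    case (snoc i w)
    let ?E = "{\<omega> \<in> E. occurs_at w \<omega> N}"
    have "p ^ length (w @ [i]) * prob E \<le> p * prob ?E"
      using snoc p_pos by simp
    also have "\<dots> \<le> prob {\<omega> \<in> ?E. \<omega> (N + length w) = i}"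
      by (rule determined_step(2)[OF det]) (use snoc.prems in auto)
    also have "{\<omega> \<in> ?E. \<omega> (N + length w) = i} = {\<omega> \<in> E. occurs_at (w @ [i]) \<omega> N}"
      by (auto simp: occurs_at_def nth_append less_Suc_eq)
    finally show ?case .
  qed
qed

text \<open>Look for \<open>w\<close> only in consecutive blocks of its own length. Each block differs from \<open>w\<close> with
conditional probability at most \<open>1 - p ^ length w\<close>, so that \<open>m\<close> blocks all do with probability at
most \<open>(1 - p ^ length w) ^ m\<close>.\<close>

lemma word_occurs_almost_surely:
  assumes w: "w \<in> lists {1..k}" and k: "k \<ge> 1"
  shows "{\<omega> \<in> symbol_seqs k. \<forall>n. \<not> occurs_at w \<omega> n} \<in> null_sets P"
proof -
  let ?n = "length w"
  define A where "A m = {\<omega> \<in> symbol_seqs k. \<forall>q<m. \<not> occurs_at w \<omega> (q * ?n)}" for m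
  have det: "determined_by (m * ?n) (A m)" for m
    unfolding determined_by_def
  proof (intro conjI ballI subsetI)
    fix \<omega> \<omega>' assume a: "\<omega> \<in> A m" "\<omega>' \<in> cylinder \<omega> (m * ?n)"
    have "\<not> occurs_at w \<omega>' (q * ?n)" if q: "q < m" for q
    proof -
      have "Suc q * ?n \<le> m * ?n" using q by (intro mult_le_mono1) simp
      then have "\<omega>' (q * ?n + j) = \<omega> (q * ?n + j)" if "j < ?n" for j
        using a(2) that by (simp add: cylinder_def)
      then show ?thesis using a(1) q by (auto simp: A_def occurs_at_def)
    qed
    then show "\<omega>' \<in> A m" using a(2) by (simp add: A_def cylinder_def)
  qed (auto simp: A_def)
  have A_sets: "A m \<in> sets P" for m using determined_step(1)[OF det, of 1] k by simp
  have bound: "prob (A m) \<le> (1 - p ^ ?n) ^ m" for m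
  proof (induction m)
    case 0 then show ?case by simp
  next
    case (Suc m)
    let ?B = "{\<omega> \<in> A m. occurs_at w \<omega> (m * ?n)}"
    have "A (Suc m) = A m - ?B" by (auto simp: A_def less_Suc_eq)
    moreover have "?B \<in> sets P" using determined_step(1)[OF determined_word(1)[OF det w], of 1] k by simp
    ultimately have "prob (A (Suc m)) = prob (A m) - prob ?B"
      using finite_measure_Diff[OF A_sets] by auto
    also have "\<dots> \<le> (1 - p ^ ?n) * prob (A m)"
      using determined_word(2)[OF det w] by (simp add: algebra_simps)
    also have "\<dots> \<le> (1 - p ^ ?n) * (1 - p ^ ?n) ^ m"
      by (rule mult_left_mono[OF Suc]) (use p_pos p_le_1 in \<open>simp add: power_le_one\<close>)
    finally show ?case by simp
  qed
  let ?Z = "{\<omega> \<in> symbol_seqs k. \<forall>n. \<not> occurs_at w \<omega> n}"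
  have "?Z = symbol_seqs k - (\<Union>n. {\<omega> \<in> symbol_seqs k. occurs_at w \<omega> n})" by auto
  moreover have "symbol_seqs k \<in> sets P" using sets.top[of P] by (simp add: space_P)
  ultimately have Z: "?Z \<in> sets P" using occurs_in_sets by auto
  have "prob ?Z \<le> (1 - p ^ ?n) ^ m" for m
  proof -
    have "prob ?Z \<le> prob (A m)" by (rule finite_measure_mono[OF _ A_sets]) (auto simp: A_def)
    then show ?thesis using bound[of m] by linarith
  qed
  moreover have "(\<lambda>m. (1 - p ^ ?n) ^ m) \<longlonglongrightarrow> 0"
  proof (rule LIMSEQ_realpow_zero)
    show "0 \<le> 1 - p ^ ?n" using p_pos p_le_1 by (simp add: power_le_one)
    show "1 - p ^ ?n < 1" using p_pos by simp
  qed
  ultimately have "prob ?Z \<le> 0" by (intro LIMSEQ_le_const) auto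
  then have "prob ?Z = 0" using measure_nonneg[of P ?Z] by linarith
  then show ?thesis using Z by (simp add: null_sets_def emeasure_eq_measure)
qed

lemma disjunctive_almost_surely:
  assumes "k \<ge> 1"
  shows "disjunctive_seqs k \<in> sets P" "prob (disjunctive_seqs k) = 1"
proof -
  let ?Z = "\<Union>w\<in>lists {1..k}. {\<omega> \<in> symbol_seqs k. \<forall>n. \<not> occurs_at w \<omega> n}"
  have null: "?Z \<in> null_sets P"
    by (rule null_sets_UN') (auto intro: word_occurs_almost_surely assms countable_lists)
  have eq: "disjunctive_seqs k = space P - ?Z" by (auto simp: disjunctive_seqs_def space_P)
  show "disjunctive_seqs k \<in> sets P" unfolding eq using null by auto
  have "prob (space P - ?Z) = 1 - prob ?Z" using null by (intro prob_compl) auto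
  moreover have "prob ?Z = 0" using null by (simp add: measure_eq_0_null_sets)
  ultimately show "prob (disjunctive_seqs k) = 1" unfolding eq by simp
qed

end

section \<open>Circle homeomorphisms without periodic points\<close>

definition shrinks_arc :: "(real \<Rightarrow> real) \<Rightarrow> real \<Rightarrow> real \<Rightarrow> bool" where
  "shrinks_arc H a b \<longleftrightarrow> a < b \<and> (\<forall>\<epsilon>>0. \<exists>n. (H ^^ n) b - (H ^^ n) a < \<epsilon>)"

lemma circle_lift_strict_mono: "circle_lift H \<Longrightarrow> H s < H t \<longleftrightarrow> s < t"
  by (simp add: circle_lift_def strict_mono_less)

lemma circle_lift_mono: "circle_lift H \<Longrightarrow> H s \<le> H t \<longleftrightarrow> s \<le> t"
  by (simp add: circle_lift_def strict_mono_less_eq)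

lemma circle_lift_inj: "circle_lift H \<Longrightarrow> H s = H t \<longleftrightarrow> s = t"
  by (simp add: circle_lift_def strict_mono_eq)

lemma circle_lift_isCont: "circle_lift H \<Longrightarrow> isCont H t"
  by (simp add: circle_lift_def continuous_on_eq_continuous_at)

lemma circle_lift_funpow: "circle_lift H \<Longrightarrow> circle_lift (H ^^ n)"
proof (induction n)
  case 0 then show ?case using circle_lift_id by (simp add: id_def)
next
  case (Suc n)
  then have "circle_lift (\<lambda>t. H ((H ^^ n) t))" using circle_lift_compose[of H "H ^^ n"] by blast
  then show ?case by (simp add: o_def)
qed

lemma circle_lift_shift: "circle_lift H \<Longrightarrow> circle_lift (\<lambda>t. H t - of_int r)"
  by (auto simp: circle_lift_def strict_mono_def intro!: continuous_intros)

lemma funpow_shift_lift: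
  assumes "circle_lift H"
  shows "((\<lambda>t. (H ^^ n) t - of_int r) ^^ j) t = (H ^^ (n * j)) t - of_int (r * int j)"
proof (induction j)
  case 0 then show ?case by simp
next
  case (Suc j)
  have "((\<lambda>t. (H ^^ n) t - of_int r) ^^ Suc j) t = (H ^^ n) ((H ^^ (n * j)) t + of_int (- (r * int j))) - of_int r"
    using Suc by simp
  also have "\<dots> = (H ^^ n) ((H ^^ (n * j)) t) + of_int (- (r * int j)) - of_int r"
    by (simp only: circle_lift_add_int[OF circle_lift_funpow[OF assms]])
  also have "(H ^^ n) ((H ^^ (n * j)) t) = (H ^^ (n * Suc j)) t"
    by (simp add: funpow_add)
  finally show ?case by (simp add: algebra_simps)
qed

lemma circle_lift_surj:
  assumes "circle_lift H" shows "\<exists>t. H t = y"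
proof -
  define n where "n = \<lceil>\<bar>y - H 0\<bar>\<rceil>"
  have n: "\<bar>y - H 0\<bar> \<le> of_int n" unfolding n_def by linarith
  then have "(0::real) \<le> of_int n" by linarith
  have "H (0 + of_int (- n)) \<le> y" "y \<le> H (0 + of_int n)"
    using n unfolding circle_lift_add_int[OF assms] by auto
  then show ?thesis
    using IVT'[of H "of_int (- n)" y "of_int n"] assms \<open>0 \<le> of_int n\<close>
    by (auto simp: circle_lift_def intro: continuous_on_subset)
qed

lemma orbit_limit_fixed:
  fixes H :: "real \<Rightarrow> real"
  assumes "isCont H L" "(\<lambda>j. (H ^^ j) t) \<longlonglongrightarrow> L"
  shows "H L = L"
proof -
  have "(\<lambda>j. H ((H ^^ j) t)) \<longlonglongrightarrow> H L" using isCont_tendsto_compose assms by blast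
  moreover have "(\<lambda>j. H ((H ^^ j) t)) \<longlonglongrightarrow> L" using LIMSEQ_Suc[OF assms(2)] by simp
  ultimately show ?thesis using LIMSEQ_unique by blast
qed

lemma lift_orbit_monotone:
  assumes "circle_lift H"
  shows "monoseq (\<lambda>j. (H ^^ j) t)"
proof (cases "t \<le> H t")
  case True
  have "(H ^^ j) t \<le> (H ^^ Suc j) t" for j
    using True circle_lift_mono[OF circle_lift_funpow[OF assms]] by (simp add: funpow_swap1)
  then show ?thesis by (simp add: monoseq_Suc)
next
  case False
  then have "(H ^^ Suc j) t \<le> (H ^^ j) t" for j
    using circle_lift_mono[OF circle_lift_funpow[OF assms]] by (simp add: funpow_swap1)
  then show ?thesis by (simp add: monoseq_Suc)
qed

lemma bounded_lift_orbit_converges: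
  assumes "circle_lift H" "\<And>j. \<bar>(H ^^ j) t\<bar> \<le> B"
  shows "\<exists>L. (\<lambda>j. (H ^^ j) t) \<longlonglongrightarrow> L"
proof -
  have "Bseq (\<lambda>j. (H ^^ j) t)" using assms(2) by (intro BseqI'[of _ B]) simp
  then show ?thesis
    using Bseq_monoseq_convergent[OF _ lift_orbit_monotone[OF assms(1)]] convergent_def by blast
qed

text \<open>The orbit of a moved point \<open>t\<close> is monotone and confined between fixed points, so it converges;
the iterates of the arc between \<open>t\<close> and \<open>H t\<close> are the arcs between consecutive points of the orbit.\<close>

lemma fixed_point_shrinks_arc:
  assumes H: "circle_lift H" and fixq: "H q = q" and moved: "H t \<noteq> t"
  shows "\<exists>a b. shrinks_arc H a b"
proof -
  define n where "n = \<lceil>\<bar>t - q\<bar>\<rceil>"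
  have n: "q + of_int (- n) \<le> t" "t \<le> q + of_int n" unfolding n_def by linarith+
  have fixn: "(H ^^ j) (q + of_int r) = q + of_int r" for j r
    by (induction j) (auto simp: circle_lift_add_int[OF H] fixq)
  have "\<bar>(H ^^ j) t\<bar> \<le> \<bar>q\<bar> + of_int n" for j
  proof -
    have "(H ^^ j) (q + of_int (- n)) \<le> (H ^^ j) t" "(H ^^ j) t \<le> (H ^^ j) (q + of_int n)"
      using n circle_lift_mono[OF circle_lift_funpow[OF H]] by blast+
    then show ?thesis unfolding fixn by simp
  qed
  then obtain l where l: "(\<lambda>j. (H ^^ j) t) \<longlonglongrightarrow> l" using bounded_lift_orbit_converges[OF H] by blast
  have "(\<lambda>j. (H ^^ Suc j) t - (H ^^ j) t) \<longlonglongrightarrow> l - l"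
    by (intro tendsto_diff l LIMSEQ_Suc[OF l])
  then have lim: "(\<lambda>j. (H ^^ j) (H t) - (H ^^ j) t) \<longlonglongrightarrow> 0" by (simp add: funpow_swap1)
  have small: "\<exists>j. \<bar>(H ^^ j) (H t) - (H ^^ j) t\<bar> < \<epsilon>" if "\<epsilon> > 0" for \<epsilon>
    using LIMSEQ_D[OF lim that] by auto
  show ?thesis
  proof (cases "t < H t")
    case True
    then have "shrinks_arc H t (H t)" unfolding shrinks_arc_def using small abs_less_iff by metis
    then show ?thesis by blast
  next
    case False
    then have "H t < t" using moved by simp
    then have "shrinks_arc H (H t) t" unfolding shrinks_arc_def using small abs_less_iff
      by (metis minus_diff_eq)
    then show ?thesis by blast
  qed
qed

text \<open>The displacement of a lift has period one, so \<open>s\<close> and \<open>t\<close> may be assumed to be at distance at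
most one, and then monotonicity applies.\<close>

lemma displacement_oscillation:
  assumes "circle_lift H"
  shows "\<bar>(H t - t) - (H s - s)\<bar> \<le> 1"
proof -
  define n where "n = \<lfloor>t - s\<rfloor>"
  have n: "s + of_int n \<le> t" "t \<le> (s + 1) + of_int n" unfolding n_def by linarith+
  then have "H (s + of_int n) \<le> H t" "H t \<le> H ((s + 1) + of_int n)"
    using circle_lift_mono[OF assms] by blast+
  then have "H s + of_int n \<le> H t" "H t \<le> H s + 1 + of_int n"
    using assms unfolding circle_lift_add_int[OF assms] by (simp_all add: circle_lift_def)
  then show ?thesis using n by linarith
qed

lemma iterate_displacement:
  fixes H :: "real \<Rightarrow> real"
  assumes "\<And>t. c \<le> H t - t \<and> H t - t \<le> d"
  shows "real m * c \<le> (H ^^ m) t - t \<and> (H ^^ m) t - t \<le> real m * d"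
proof (induction m)
  case (Suc m)
  then show ?case using assms[of "(H ^^ m) t"] by (simp add: algebra_simps)
qed simp

text \<open>The displacement of \<open>H ^^ n\<close> is everywhere within distance one of its value \<open>a n\<close> at \<open>0\<close>. Iterating
\<open>m\<close> times and exchanging \<open>m\<close> and \<open>n\<close> gives \<open>(a n - 1) / n \<le> (a m + 1) / m\<close> for all \<open>m\<close> and \<open>n\<close>, so
a single number separates the two families of quotients.\<close>

lemma translation_number_exists:
  assumes H: "circle_lift H"
  shows "\<exists>\<alpha>. \<forall>n t. \<bar>(H ^^ n) t - t - of_nat n * \<alpha>\<bar> \<le> 2"
proof -
  define a where "a n = (H ^^ n) 0" for n
  have disp: "a n - 1 \<le> (H ^^ n) t - t \<and> (H ^^ n) t - t \<le> a n + 1" for n t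
    using displacement_oscillation[OF circle_lift_funpow[OF H], of n t 0] unfolding a_def by simp linarith
  \<comment> \<open>Both sides estimate the displacement of \<open>H ^^ (n * m)\<close> at \<open>0\<close>.\<close>
  have cross: "m * (a n - 1) \<le> n * (a m + 1)" for n m
  proof -
    have "m * (a n - 1) \<le> ((H ^^ n) ^^ m) 0 - 0"
      using iterate_displacement[where c="a n - 1" and H="H ^^ n" and d="a n + 1" and m=m and t=0] disp by blast
    moreover have "((H ^^ m) ^^ n) 0 - 0 \<le> n * (a m + 1)"
      using iterate_displacement[where c="a m - 1" and H="H ^^ m" and d="a m + 1" and m=n and t=0] disp by blast
    moreover have "(H ^^ n) ^^ m = (H ^^ m) ^^ n" by (simp add: funpow_mult mult.commute)
    ultimately show ?thesis by simp
  qed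
  define \<alpha> where "\<alpha> = Sup ((\<lambda>n. (a n - 1) / n) ` {1..})"
  have frac: "(a n - 1) / n \<le> (a m + 1) / m" if "n \<ge> 1" "m \<ge> 1" for n m
    using cross[of m n] that by (simp add: field_simps)
  have upper: "\<alpha> \<le> (a m + 1) / m" if "m \<ge> 1" for m
    unfolding \<alpha>_def by (rule cSup_least) (use frac that in auto)
  have bdd: "bdd_above ((\<lambda>n. (a n - 1) / n) ` {1..})"
    using frac[of _ 1] by (auto simp: bdd_above_def)
  have lower: "(a n - 1) / n \<le> \<alpha>" if "n \<ge> 1" for n
    unfolding \<alpha>_def by (rule cSup_upper[OF _ bdd]) (use that in auto)
  have "\<bar>(H ^^ n) t - t - n * \<alpha>\<bar> \<le> 2" for n t
  proof (cases "n = 0")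
    case False
    then have "a n - 1 \<le> n * \<alpha>" "n * \<alpha> \<le> a n + 1"
      using lower[of n] upper[of n] by (simp_all add: field_simps)
    then show ?thesis using disp[of n t] by linarith
  qed simp
  then show ?thesis by blast
qed

text \<open>The finitely many points of \<open>E\<close> are separated by points at which \<open>g\<close> can be evaluated, and the
increments of a monotone function over successive intervals add up.\<close>

lemma sum_of_jumps:
  fixes g :: "real \<Rightarrow> real"
  assumes mono: "\<And>s t. s \<le> t \<Longrightarrow> g s \<le> g t" and "finite E"
    and "\<And>e s s'. e \<in> E \<Longrightarrow> s < e \<Longrightarrow> e < s' \<Longrightarrow> c \<le> g s' - g s"
    and "\<And>e. e \<in> E \<Longrightarrow> x < e \<and> e < y" "x \<le> y"
  shows "real (card E) * c \<le> g y - g x"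
  using assms(2-)
proof (induction E arbitrary: y rule: finite_linorder_max_induct)
  case empty then show ?case using mono by simp
next
  case (insert b E)
  have b: "x < b" "b < y" using insert.prems(2)[of b] by auto
  obtain s where s: "x \<le> s" "s < b" "\<And>e. e \<in> E \<Longrightarrow> e < s"
  proof -
    have "Max (insert x E) < b" using insert.hyps b by auto
    then obtain s where s: "Max (insert x E) < s" "s < b" using dense by blast
    have "e < s" if "e \<in> insert x E" for e using that insert.hyps(1) s(1) by auto
    then show ?thesis using that[of s] s by force
  qed
  have "real (card E) * c \<le> g s - g x"
    by (rule insert.IH) (use insert.prems s in auto)
  moreover have "c \<le> g y - g s" using insert.prems(1)[of b s y] s b by simp
  moreover have "card (insert b E) = Suc (card E)" using insert.hyps by (simp add: card_insert_if) force
  ultimately show ?case by (simp add: algebra_simps)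
qed


text \<open>These are the numbers \<open>H\<^sup>n t - n * \<alpha>\<close> for all integers \<open>n\<close>, negative ones included, with \<open>n = a - b\<close>
and the inverse of \<open>H ^^ b\<close> written as a solution \<open>u\<close> of an equation.\<close>

definition semiconj_values :: "(real \<Rightarrow> real) \<Rightarrow> real \<Rightarrow> real \<Rightarrow> real set" where
  "semiconj_values H \<alpha> t = {u - (real a - real b) * \<alpha> | u a b. (H ^^ b) u = (H ^^ a) t}"

text \<open>Put \<open>G t\<close> equal to the supremum over all integers \<open>n\<close> of \<open>H\<^sup>n t - n * \<alpha>\<close>, which is finite as these
numbers stay within a bounded distance of \<open>t\<close>. Replacing \<open>t\<close> by \<open>H t\<close> shifts the index \<open>n\<close> and adds
\<open>\<alpha>\<close>; this requires that \<open>n\<close> ranges over all integers and not only over the natural numbers.\<close>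

lemma semiconjugacy_exists:
  assumes H: "circle_lift H" and \<alpha>: "\<And>n t. \<bar>(H ^^ n) t - t - of_nat n * \<alpha>\<bar> \<le> 2"
  shows "\<exists>G. mono G \<and> (\<forall>t. G (t + 1) = G t + 1) \<and> (\<forall>t. G (H t) = G t + \<alpha>)"
proof -
  let ?S = "semiconj_values H \<alpha>"
  define G where "G t = Sup (?S t)" for t
  have bdd: "bdd_above (?S t)" for t
  proof (rule bdd_aboveI)
    fix c assume "c \<in> ?S t"
    then obtain u a b where c: "c = u - (real a - real b) * \<alpha>" "(H ^^ b) u = (H ^^ a) t"
      unfolding semiconj_values_def by blast
    then show "c \<le> t + 4" using \<alpha>[of b u] \<alpha>[of a t] by (simp add: algebra_simps)
  qed
  have ne: "?S t \<noteq> {}" for t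
  proof -
    have "(H ^^ 0) t = (H ^^ 0) t" by simp
    then have "t - (real 0 - real 0) * \<alpha> \<in> ?S t" unfolding semiconj_values_def by blast
    then show ?thesis by blast
  qed
  have shift: "G s + d \<le> G t" if dominated: "\<And>c. c \<in> ?S s \<Longrightarrow> \<exists>c'\<in>?S t. c + d \<le> c'" for s t d
  proof -
    have "G s \<le> G t - d" unfolding G_def[of s]
    proof (rule cSup_least[OF ne])
      fix c assume "c \<in> ?S s"
      then obtain c' where "c' \<in> ?S t" "c + d \<le> c'" using dominated by blast
      moreover from this have "c' \<le> G t" unfolding G_def by (intro cSup_upper bdd)
      ultimately show "c \<le> G t - d" by simp
    qed
    then show ?thesis by simp
  qed
  have lifts: "circle_lift (H ^^ n)" for n by (rule circle_lift_funpow[OF H])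
  have "G s + 0 \<le> G t" if "s \<le> t" for s t
  proof (rule shift)
    fix c assume "c \<in> ?S s"
    then obtain u a b where c: "c = u - (real a - real b) * \<alpha>" "(H ^^ b) u = (H ^^ a) s"
      unfolding semiconj_values_def by blast
    obtain u' where u': "(H ^^ b) u' = (H ^^ a) t" using circle_lift_surj[OF lifts] by blast
    have "(H ^^ b) u \<le> (H ^^ b) u'" using c(2) u' that circle_lift_mono[OF lifts] by simp
    then have "u \<le> u'" using circle_lift_mono[OF lifts] by blast
    moreover have "u' - (real a - real b) * \<alpha> \<in> ?S t" using u' unfolding semiconj_values_def by blast
    ultimately show "\<exists>c'\<in>?S t. c + 0 \<le> c'" using c(1)
      by (intro bexI[of _ "u' - (real a - real b) * \<alpha>"]) simp_all
  qed
  then have "mono G" by (intro monoI) simp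
  moreover
  have add: "G t + of_int n \<le> G (t + of_int n)" for t n
  proof (rule shift)
    fix c assume "c \<in> ?S t"
    then obtain u a b where c: "c = u - (real a - real b) * \<alpha>" "(H ^^ b) u = (H ^^ a) t"
      unfolding semiconj_values_def by blast
    then have "(H ^^ b) (u + of_int n) = (H ^^ a) (t + of_int n)"
      by (simp add: circle_lift_add_int[OF lifts])
    then have "(u + of_int n) - (real a - real b) * \<alpha> \<in> ?S (t + of_int n)"
      unfolding semiconj_values_def by blast
    then show "\<exists>c'\<in>?S (t + of_int n). c + of_int n \<le> c'" using c(1)
      by (intro bexI[of _ "(u + of_int n) - (real a - real b) * \<alpha>"]) simp_all
  qed
  have "G (t + 1) = G t + 1" for t
    using add[of t 1] add[of "t + 1" "-1"] by simp
  moreover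
  have "G t + \<alpha> \<le> G (H t)" for t
  proof (rule shift)
    fix c assume "c \<in> ?S t"
    then obtain u a b where c: "c = u - (real a - real b) * \<alpha>" "(H ^^ b) u = (H ^^ a) t"
      unfolding semiconj_values_def by blast
    then have "(H ^^ Suc b) u = (H ^^ a) (H t)" by (simp add: funpow_swap1[symmetric])
    then have "u - (real a - real (Suc b)) * \<alpha> \<in> ?S (H t)" unfolding semiconj_values_def by blast
    then show "\<exists>c'\<in>?S (H t). c + \<alpha> \<le> c'" using c(1)
      by (intro bexI[of _ "u - (real a - real (Suc b)) * \<alpha>"]) (simp_all add: algebra_simps)
  qed
  moreover
  have "G (H t) + (- \<alpha>) \<le> G t" for t
  proof (rule shift)
    fix c assume "c \<in> ?S (H t)"
    then obtain u a b where c: "c = u - (real a - real b) * \<alpha>" "(H ^^ b) u = (H ^^ a) (H t)"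
      unfolding semiconj_values_def by blast
    then have "(H ^^ b) u = (H ^^ Suc a) t" by (simp add: funpow_swap1)
    then have "u - (real (Suc a) - real b) * \<alpha> \<in> ?S t" unfolding semiconj_values_def by blast
    then show "\<exists>c'\<in>?S t. c + (- \<alpha>) \<le> c'" using c(1)
      by (intro bexI[of _ "u - (real (Suc a) - real b) * \<alpha>"]) (simp_all add: algebra_simps)
  qed
  ultimately have "mono G \<and> (\<forall>t. G (t + 1) = G t + 1) \<and> (\<forall>t. G (H t) = G t + \<alpha>)"
    by (smt (verit))
  then show ?thesis by blast
qed

locale semiconjugacy =
  fixes H G :: "real \<Rightarrow> real" and \<alpha> :: real
  assumes H: "circle_lift H"
    and no_periodic: "\<And>n t m. n \<ge> 1 \<Longrightarrow> (H ^^ n) t \<noteq> t + of_int m"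
    and \<alpha>: "\<And>n t. \<bar>(H ^^ n) t - t - of_nat n * \<alpha>\<bar> \<le> 2"
    and mono_G: "mono G" and G_1: "\<And>t. G (t + 1) = G t + 1"
    and G_H: "\<And>t. G (H t) = G t + \<alpha>"
begin

lemma lifts: "circle_lift (H ^^ n)"
  by (rule circle_lift_funpow[OF H])

lemma G_pow: "G ((H ^^ n) t) = G t + of_nat n * \<alpha>"
  by (induction n) (auto simp: G_H algebra_simps)

lemma G_int: "G (t + of_int m) = G t + of_int m"
proof -
  have nat: "G (t + of_nat n) = G t + of_nat n" for t n
  proof (induction n)
    case (Suc n)
    have "G (t + of_nat (Suc n)) = G ((t + of_nat n) + 1)" by (simp add: algebra_simps)
    also have "\<dots> = G t + of_nat (Suc n)" using G_1 Suc by simp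
    finally show ?case .
  qed simp
  show ?thesis
  proof (cases "m \<ge> 0")
    case True then show ?thesis using nat[of t "nat m"] by simp
  next
    case False then show ?thesis using nat[of "t + of_int m" "nat (- m)"] by simp
  qed
qed

text \<open>If \<open>n * \<alpha> = r\<close>, then all iterates of the lift \<open>H ^^ n - r\<close> have displacement at most \<open>2\<close>. Its
monotone orbits are then bounded and converge to fixed points, which are points with
\<open>(H ^^ n) t = t + r\<close>.\<close>

lemma \<alpha>_irrational:
  assumes "n \<ge> 1" shows "real n * \<alpha> \<noteq> of_int r"
proof
  assume eq: "real n * \<alpha> = of_int r"
  let ?K = "\<lambda>t. (H ^^ n) t - of_int r"
  have K: "circle_lift ?K" by (rule circle_lift_shift[OF lifts])
  have "\<bar>(?K ^^ j) 0\<bar> \<le> 2" for j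
  proof -
    have "(?K ^^ j) 0 = (H ^^ (n * j)) 0 - 0 - of_nat (n * j) * \<alpha>"
      using eq funpow_shift_lift[OF H, where n=n and r=r and j=j and t=0] by (simp add: algebra_simps)
        (metis mult.assoc mult.commute)
    then show ?thesis using \<alpha>[of "n * j" 0] by simp
  qed
  then obtain l where "(\<lambda>j. (?K ^^ j) 0) \<longlonglongrightarrow> l" using bounded_lift_orbit_converges[OF K] by blast
  then have "?K l = l" by (rule orbit_limit_fixed[OF circle_lift_isCont[OF K]])
  then show False using no_periodic[OF assms, of l r] by simp
qed

lemma orbit_distinct_mod_1:
  assumes "j < l" shows "(H ^^ l) s \<noteq> (H ^^ j) s + of_int m"
proof -
  have "(H ^^ (l - j)) ((H ^^ j) s) = (H ^^ l) s"
    using assms by (metis comp_apply funpow_add le_add_diff_inverse2 less_imp_le)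
  then show ?thesis using no_periodic[of "l - j" "(H ^^ j) s" m] assms by simp
qed

lemma frac_shift: "\<exists>m::int. frac x = x + of_int m"
  by (intro exI[of _ "- \<lfloor>x\<rfloor>"]) (simp add: frac_def)

text \<open>By equivariance a jump of \<open>G\<close> at \<open>t\<close> is repeated with the same size at all points of the orbit of
\<open>t\<close>. They are distinct modulo one, so arbitrarily many such jumps take place between \<open>-1\<close> and
\<open>1\<close>, where \<open>G\<close> increases by \<open>2\<close> only.\<close>

lemma G_continuous: "isCont G t"
proof (rule ccontr)
  assume "\<not> isCont G t"
  then obtain \<epsilon> where \<epsilon>: "\<epsilon> > 0" "\<And>d. d > 0 \<Longrightarrow> \<exists>x. \<bar>x - t\<bar> < d \<and> \<epsilon> \<le> \<bar>G x - G t\<bar>"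
    unfolding continuous_at_eps_delta dist_real_def by (meson not_less)
  have jump: "\<epsilon> \<le> G s' - G s" if st: "s < t" "t < s'" for s s'
  proof -
    obtain x where x: "\<bar>x - t\<bar> < min (t - s) (s' - t)" "\<epsilon> \<le> \<bar>G x - G t\<bar>"
      using \<epsilon>(2)[of "min (t - s) (s' - t)"] st by auto
    then have "s \<le> x" "x \<le> s'" by auto
    then have "G s \<le> G x" "G x \<le> G s'" "G s \<le> G t" "G t \<le> G s'"
      using monoD[OF mono_G] st by auto
    then show ?thesis using x(2) by linarith
  qed
  obtain N where N: "real N * \<epsilon> > 2" using reals_Archimedean3[OF \<epsilon>(1)] by blast
  define E where "E = (\<lambda>j. frac ((H ^^ j) t)) ` {..<N}"
  have "inj_on (\<lambda>j. frac ((H ^^ j) t)) {..<N}"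
  proof (rule linorder_inj_onI)
    fix j l :: nat assume "j < l"
    obtain m m' :: int where "frac ((H ^^ j) t) = (H ^^ j) t + of_int m"
      "frac ((H ^^ l) t) = (H ^^ l) t + of_int m'" using frac_shift by metis
    then show "frac ((H ^^ j) t) \<noteq> frac ((H ^^ l) t)"
      using orbit_distinct_mod_1[OF \<open>j < l\<close>, of t "m - m'"] by auto
  qed auto
  then have card: "card E = N" unfolding E_def by (simp add: card_image)
  have "real (card E) * \<epsilon> \<le> G 1 - G (- 1)"
  proof (rule sum_of_jumps[where g=G and E=E and c=\<epsilon> and x="-1" and y=1])
    show "G s \<le> G t" if "s \<le> t" for s t using monoD[OF mono_G that] .
    show "finite E" by (simp add: E_def)
    show "- 1 < e \<and> e < 1" if e: "e \<in> E" for e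
    proof -
      obtain x where "e = frac x" using e E_def by blast
      then show ?thesis using frac_ge_0[of x] frac_lt_1[of x] by linarith
    qed
    fix e s s' assume e: "e \<in> E" "s < e" "e < s'"
    then obtain j m where m: "e = (H ^^ j) t + of_int m" unfolding E_def using frac_shift by force
    obtain r r' where r: "(H ^^ j) r = s - of_int m" "(H ^^ j) r' = s' - of_int m"
      using circle_lift_surj[OF lifts] by metis
    then have "(H ^^ j) r < (H ^^ j) t" "(H ^^ j) t < (H ^^ j) r'" using e m by auto
    then have "r < t" "t < r'" using circle_lift_strict_mono[OF lifts] by blast+
    then have "\<epsilon> \<le> G r' - G r" by (rule jump)
    also have "\<dots> = G (s' - of_int m) - G (s - of_int m)"
      using G_pow[of j r] G_pow[of j r'] r by simp
    also have "\<dots> = G s' - G s" using G_int[of s "- m"] G_int[of s' "- m"] by simp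
    finally show "\<epsilon> \<le> G s' - G s" .
  qed simp
  also have "G 1 - G (- 1) = 2" using G_int[of "-1" 2] by simp
  finally show False using N card by simp
qed

text \<open>Suppose that all the iterates of \<open>{a..b}\<close> have length at least \<open>\<epsilon>\<close>. Two of their left endpoints are
closer than \<open>\<epsilon>\<close> modulo one, so two iterates overlap modulo one. As \<open>G\<close> is constant on each of
them, its two values agree modulo one, and \<open>\<alpha>\<close> would be rational.\<close>

lemma flat_arc_shrinks:
  assumes "a < b" "G a = G b" shows "shrinks_arc H a b"
proof (rule ccontr)
  assume "\<not> shrinks_arc H a b"
  then obtain \<epsilon> where \<epsilon>: "\<epsilon> > 0" "\<And>n. \<epsilon> \<le> (H ^^ n) b - (H ^^ n) a"
    using assms(1) unfolding shrinks_arc_def by (meson not_less)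
  define q where "q j = frac ((H ^^ j) a)" for j
  have "norm (q j) \<le> 1" for j
    using frac_ge_0[of "(H ^^ j) a"] frac_lt_1[of "(H ^^ j) a"] by (simp add: q_def)
  then have "bounded (range q)" unfolding bounded_iff by blast
  then obtain l r where r: "strict_mono r" "(q \<circ> r) \<longlonglongrightarrow> l"
    using bounded_imp_convergent_subsequence by blast
  then have "Cauchy (q \<circ> r)" by (intro LIMSEQ_imp_Cauchy)
  then obtain M where M: "\<forall>i\<ge>M. \<forall>j\<ge>M. dist ((q \<circ> r) i) ((q \<circ> r) j) < \<epsilon>"
    using \<epsilon>(1) unfolding Cauchy_def by blast
  have overlap: "G (q i) = G (q j)" if ij: "q i \<le> q j" "q j < q i + \<epsilon>" for i j
  proof -
    obtain m where m: "q i = (H ^^ i) a + of_int m" using frac_shift unfolding q_def by blast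
    have "q j \<le> (H ^^ i) b + of_int m" using \<epsilon>(2)[of i] ij m by linarith
    then have "G (q j) \<le> G ((H ^^ i) b + of_int m)" by (rule monoD[OF mono_G])
    also have "\<dots> = G ((H ^^ i) a + of_int m)" by (simp add: G_int G_pow assms(2))
    finally show ?thesis using monoD[OF mono_G ij(1)] m by simp
  qed
  define i j where "i = r M" and "j = r (Suc M)"
  have "i < j" unfolding i_def j_def using r(1) by (simp add: strict_mono_less)
  have "\<bar>q i - q j\<bar> < \<epsilon>" using M[rule_format, of M "Suc M"] by (simp add: i_def j_def dist_real_def)
  then have near: "q i < q j + \<epsilon>" "q j < q i + \<epsilon>" by linarith+
  have "G (q i) = G (q j)"
  proof (cases "q i \<le> q j")
    case True then show ?thesis by (rule overlap[OF _ near(2)])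
  next
    case False
    then have "q j \<le> q i" by linarith
    then show ?thesis by (rule overlap[OF _ near(1), symmetric])
  qed
  moreover obtain m m' :: int where "q i = (H ^^ i) a + of_int m" "q j = (H ^^ j) a + of_int m'"
    using frac_shift unfolding q_def by metis
  ultimately have "G a + of_nat i * \<alpha> + of_int m = G a + of_nat j * \<alpha> + of_int m'"
    by (simp only: G_int G_pow)
  then have "real (j - i) * \<alpha> = of_int (m - m')"
    using \<open>i < j\<close> by (simp add: of_nat_diff algebra_simps)
  moreover have "j - i \<ge> 1" using \<open>i < j\<close> by simp
  ultimately show False using \<alpha>_irrational by blast
qed

end

lemma lift_of_angle_continuous:
  assumes "circle_lift G"
  shows "continuous_on circle (\<lambda>z. turn (G (Arg z / (2 * pi))))"
proof -
  have "continuous (at z within circle) (\<lambda>z. turn (G (Arg z / (2 * pi))))" if z: "z \<in> circle" for z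
  proof -
    from z obtain t where t: "z = turn t" by (rule circle_turnE)
    let ?a = "\<lambda>z. t + Arg (z / turn t) / (2 * pi)"
    have turnG: "turn (G x) = turn (G y)" if "turn x = turn y" for x y
      using that circle_lift_add_int[OF assms] by (auto simp: turn_eq_iff)
    have eq: "turn (G (Arg y / (2 * pi))) = turn (G (?a y))" if "y \<in> circle" for y
      by (rule turnG) (use that turn_Arg local_angle[OF that, of t] in simp)
    have "isCont turn x" for x
      using continuous_on_turn[of UNIV] by (simp add: continuous_on_eq_continuous_at)
    then have "isCont (\<lambda>y. turn (G (?a y))) (turn t)"
      using isCont_local_angle[of t] circle_lift_isCont[OF assms] by (metis isCont_o2)
    then have "continuous (at z within circle) (\<lambda>y. turn (G (?a y)))"
      unfolding t by (rule continuous_at_imp_continuous_at_within)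
    then show ?thesis
      by (rule continuous_transform_within[where \<delta>=1]) (use z eq in auto)
  qed
  then show ?thesis by (simp add: continuous_on_eq_continuous_within)
qed

lemma conjugate_to_rotation_if_lift:
  assumes h: "\<And>t. h (turn t) = turn (H t)" and G: "circle_lift G" and conj: "\<And>t. G (H t) = G t + \<alpha>"
  shows "conjugate_to_rotation h"
proof -
  define \<phi> where "\<phi> z = turn (G (Arg z / (2 * pi)))" for z
  have \<phi>: "\<phi> (turn t) = turn (G t)" for t
  proof -
    obtain n :: int where "Arg (turn t) / (2 * pi) = t + of_int n"
      using turn_Arg[of "turn t"] by (auto simp: turn_eq_iff)
    then show ?thesis by (simp add: \<phi>_def circle_lift_add_int[OF G])
  qed
  have "\<phi> ` circle = circle"
  proof (intro equalityI subsetI)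
    fix z assume "z \<in> circle"
    then obtain t where "z = turn t" by (rule circle_turnE)
    moreover obtain s where "G s = t" using circle_lift_surj[OF G] by blast
    ultimately have "z = \<phi> (turn s)" by (simp add: \<phi>)
    then show "z \<in> \<phi> ` circle" using turn_in_circle(1) by blast
  qed (auto simp: \<phi>_def)
  moreover have "inj_on \<phi> circle"
  proof (rule inj_onI)
    fix x y assume xy: "x \<in> circle" "y \<in> circle" and eq: "\<phi> x = \<phi> y"
    obtain s t where st: "x = turn s" "y = turn t" using xy circle_turnE by metis
    then obtain n :: int where "G s = G t + of_int n" using eq by (auto simp: \<phi> turn_eq_iff)
    then have "G s = G (t + of_int n)" by (simp add: circle_lift_add_int[OF G])
    then have "s = t + of_int n" using circle_lift_inj[OF G] by blast
    then show "x = y" using st by simp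
  qed
  moreover have "continuous_on circle \<phi>"
    unfolding \<phi>_def by (rule lift_of_angle_continuous[OF G])
  ultimately obtain \<psi> where "homeomorphism circle circle \<phi> \<psi>"
    using homeomorphism_compact[of circle \<phi> circle] by auto
  moreover have "\<phi> (h z) = cis (2 * pi * \<alpha>) * \<phi> z" if "z \<in> circle" for z
  proof -
    from that obtain t where "z = turn t" by (rule circle_turnE)
    then have "\<phi> (h z) = turn (\<alpha> + G t)" by (simp add: h \<phi> conj add.commute)
    also have "\<dots> = turn \<alpha> * \<phi> z" unfolding turn_add \<open>z = turn t\<close> \<phi> by (rule refl)
    finally show ?thesis by (simp only: turn_def)
  qed
  ultimately show ?thesis unfolding conjugate_to_rotation_def by blast
qed

theorem conjugate_or_shrinks_arc:
  assumes H: "circle_lift H" and no_periodic: "\<And>n t m. n \<ge> 1 \<Longrightarrow> (H ^^ n) t \<noteq> t + of_int m"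
    and h: "\<And>t. h (turn t) = turn (H t)" and not_conj: "\<not> conjugate_to_rotation h"
  shows "\<exists>a b. shrinks_arc H a b"
proof -
  obtain \<alpha> where \<alpha>: "\<forall>n t. \<bar>(H ^^ n) t - t - of_nat n * \<alpha>\<bar> \<le> 2"
    using translation_number_exists[OF H] by blast
  then obtain G where G: "mono G" "\<forall>t. G (t + 1) = G t + 1" "\<forall>t. G (H t) = G t + \<alpha>"
    using semiconjugacy_exists[OF H] by blast
  interpret semiconjugacy H G \<alpha>
    by unfold_locales (use H no_periodic \<alpha> G in auto)
  have "\<not> strict_mono G"
  proof
    assume "strict_mono G"
    then have "circle_lift G"
      using G G_continuous by (simp add: circle_lift_def continuous_on_eq_continuous_at)
    then show False using conjugate_to_rotation_if_lift[of h H G \<alpha>] h G(3) not_conj by blast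
  qed
  then obtain a b where "a < b" "\<not> G a < G b" unfolding strict_mono_def by blast
  moreover from this have "G a \<le> G b" using monoD[OF G(1)] by simp
  ultimately show ?thesis using flat_arc_shrinks[of a b] by force
qed

section \<open>Density of periodic points\<close>

text \<open>The image under \<open>H\<close> is connected and lies in a union of disjoint translates of the open
interval, hence in a single translate by some integer \<open>m\<close>; the intermediate value theorem
applies to \<open>H t - t\<close> with the value \<open>m\<close>.\<close>

lemma arc_self_map_fixed_point:
  fixes H :: "real \<Rightarrow> real"
  assumes cont: "continuous_on UNIV H" and "\<eta> > 0" "\<eta> < 1/2"
    and self: "\<And>t. t \<in> {c - \<eta>..c + \<eta>} \<Longrightarrow> turn (H t) \<in> turn ` {c - \<eta><..<c + \<eta>}"
  shows "\<exists>t\<in>{c - \<eta>..c + \<eta>}. turn (H t) = turn t"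
proof -
  let ?I = "{c - \<eta>..c + \<eta>}"
  have in_strip: "\<exists>n::int. c - \<eta> + of_int n < H t \<and> H t < c + \<eta> + of_int n" if t: "t \<in> ?I" for t
  proof -
    obtain s where s: "s \<in> {c - \<eta><..<c + \<eta>}" "turn (H t) = turn s" using self[OF t] by blast
    then obtain n :: int where "H t = s + of_int n" by (auto simp: turn_eq_iff)
    then show ?thesis using s(1) by (intro exI[of _ n]) simp
  qed
  have cont_I: "continuous_on {x..y} H" for x y using cont by (rule continuous_on_subset) simp
  have "c \<in> ?I" using assms(2) by simp
  from in_strip[OF this] obtain m :: int where m: "c - \<eta> + of_int m < H c" "H c < c + \<eta> + of_int m" by blast
  have not_edge: "H t \<noteq> c + \<eta> + of_int m" "H t \<noteq> c - \<eta> + of_int m" if t: "t \<in> ?I" for t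
  proof -
    obtain n :: int where n: "c - \<eta> + of_int n < H t" "H t < c + \<eta> + of_int n" using in_strip[OF t] by blast
    show "H t \<noteq> c + \<eta> + of_int m"
    proof
      assume "H t = c + \<eta> + of_int m"
      then have "real_of_int m < of_int n" "real_of_int n < of_int (m + 1)" using n assms(3) by simp_all
      then show False unfolding of_int_less_iff by simp
    qed
    show "H t \<noteq> c - \<eta> + of_int m"
    proof
      assume "H t = c - \<eta> + of_int m"
      then have "real_of_int n < of_int m" "real_of_int m < of_int (n + 1)" using n assms(3) by simp_all
      then show False unfolding of_int_less_iff by simp
    qed
  qed
  have strip: "c - \<eta> + of_int m < H t \<and> H t < c + \<eta> + of_int m" if t: "t \<in> ?I" for t
  proof (rule ccontr)
    assume out: "\<not> ?thesis"
    have sub: "closed_segment t c \<subseteq> ?I" using t \<open>c \<in> ?I\<close>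
      by (intro closed_segment_subset) auto
    have "connected (H ` closed_segment t c)"
      using cont by (intro connected_continuous_image) (auto intro: continuous_on_subset)
    moreover have "H t \<in> H ` closed_segment t c" "H c \<in> H ` closed_segment t c" by auto
    ultimately have between: "y \<in> H ` closed_segment t c" if "H t \<le> y \<and> y \<le> H c \<or> H c \<le> y \<and> y \<le> H t" for y
      using that by (meson connectedD_interval)
    from out have "c + \<eta> + of_int m \<in> H ` closed_segment t c \<or> c - \<eta> + of_int m \<in> H ` closed_segment t c"
      using between[of "c + \<eta> + of_int m"] between[of "c - \<eta> + of_int m"] m by linarith
    then show False
    proof (elim disjE imageE)
      fix s assume "c + \<eta> + of_int m = H s" "s \<in> closed_segment t c"
      then show False using not_edge(1)[of s] subsetD[OF sub, of s] by metis
    next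
      fix s assume "c - \<eta> + of_int m = H s" "s \<in> closed_segment t c"
      then show False using not_edge(2)[of s] subsetD[OF sub, of s] by metis
    qed
  qed
  have "\<exists>t\<ge>c - \<eta>. t \<le> c + \<eta> \<and> H t - t = of_int m"
  proof (rule IVT2')
    show "H (c + \<eta>) - (c + \<eta>) \<le> of_int m" "of_int m \<le> H (c - \<eta>) - (c - \<eta>)"
      using strip[of "c + \<eta>"] strip[of "c - \<eta>"] assms(2) by auto
  qed (use assms(2) cont_I in \<open>auto intro!: continuous_intros\<close>)
  then obtain t where t: "t \<in> ?I" "H t = t + of_int m" by force
  then show ?thesis by (intro bexI[of _ t]) auto
qed

context minimal_circle_IFS begin

lemma word_preimage_open:
  assumes "v \<in> lists {1..k}" "open V"
  shows "\<exists>A. open A \<and> A \<inter> circle = fold f v -` V \<inter> circle"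
  using continuous_on_fold[of k circle f v] cont_f f_closed assms
  unfolding continuous_on_open_invariant by blast

text \<open>The radius \<open>e\<close> is a Lebesgue number of the cover of the circle by the preimages of \<open>V\<close> under words.\<close>

lemma uniform_steering:
  assumes V: "open V" "V \<inter> circle \<noteq> {}"
  shows "\<exists>e>0. \<forall>z\<in>circle. \<exists>w\<in>lists {1..k}. fold f w ` (ball z e \<inter> circle) \<subseteq> V"
proof -
  obtain A where A: "\<And>w. w \<in> lists {1..k} \<Longrightarrow> open (A w) \<and> A w \<inter> circle = fold f w -` V \<inter> circle"
    using word_preimage_open[OF _ V(1)] by metis
  have "circle \<subseteq> \<Union> (A ` lists {1..k})"
  proof
    fix x :: complex assume x: "x \<in> circle"
    obtain w where w: "w \<in> lists {1..k}" "fold f w x \<in> V"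
      using IFS_minimal_word[OF forward_minimal x V] by blast
    then have "x \<in> A w" using A[OF w(1)] x by blast
    then show "x \<in> \<Union> (A ` lists {1..k})" using w(1) by blast
  qed
  moreover have "\<And>B. B \<in> A ` lists {1..k} \<Longrightarrow> open B" using A by blast
  moreover have "compact circle" by simp
  ultimately obtain e where e: "0 < e" "\<And>x. x \<in> circle \<Longrightarrow> \<exists>B\<in>A ` lists {1..k}. ball x e \<subseteq> B"
    using Heine_Borel_lemma by metis
  have "\<exists>w\<in>lists {1..k}. fold f w ` (ball z e \<inter> circle) \<subseteq> V" if z: "z \<in> circle" for z
  proof -
    obtain w where "w \<in> lists {1..k}" "ball z e \<subseteq> A w" using e(2)[OF z] by blast
    then show ?thesis using A by blast
  qed
  then show ?thesis using e(1) by blast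
qed

text \<open>Near a given point \<open>z = turn c\<close>, a word \<open>u\<close> takes a small arc \<open>N\<close> around \<open>z\<close> into the arc between
\<open>a\<close> and \<open>b\<close>, a word \<open>v\<close> makes its image shorter than the radius of \<open>uniform_steering\<close>, and a word \<open>w\<close>
takes the result into \<open>N\<close>. The word \<open>u\<close> is chosen nonempty so that the whole word
represents an element of the semigroup.\<close>

lemma periodic_points_dense_if_arc_shrinks:
  assumes "a < b"
    and shrinks: "\<And>\<epsilon>. \<epsilon> > 0 \<Longrightarrow> \<exists>v\<in>lists {1..k}. fold F v b - fold F v a < \<epsilon>"
  shows "closure (IFS_periodic_points circle k f) = circle"
proof
  have "IFS_periodic_points circle k f \<subseteq> circle" by (auto simp: IFS_periodic_points_def)
  then show "closure (IFS_periodic_points circle k f) \<subseteq> circle" by (intro closure_minimal) auto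
  show "circle \<subseteq> closure (IFS_periodic_points circle k f)"
  proof
    fix z assume z: "z \<in> circle"
    then obtain c where c: "z = turn c" by (rule circle_turnE)
    have "\<exists>y\<in>IFS_periodic_points circle k f. dist y z < e" if "e > 0" for e
    proof -
      define \<eta>0 where "\<eta>0 = (b - a) / 2"
      have \<eta>0: "(a + b) / 2 - \<eta>0 = a" "(a + b) / 2 + \<eta>0 = b" "\<eta>0 > 0"
        using assms(1) by (auto simp: \<eta>0_def field_simps)
      obtain V where V: "open V" "turn ((a + b) / 2) \<in> V" "V \<inter> circle \<subseteq> turn ` {a<..<b}"
        using arc_neighbourhood[OF \<eta>0(3), of "(a + b) / 2"] \<eta>0 by auto
      have "V \<inter> circle \<noteq> {}" using V(2) turn_in_circle(1) by blast
      then obtain u where u: "u \<in> lists {1..k}" "u \<noteq> []" "fold f u z \<in> V"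
        using IFS_minimal_word[OF forward_minimal z V(1)] by blast
      obtain A where A: "open A" "A \<inter> circle = fold f u -` V \<inter> circle"
        using word_preimage_open[OF u(1) V(1)] by blast
      have "z \<in> A \<inter> circle" using u(3) z A(2) by blast
      then have "turn c \<in> A \<inter> ball z e" using c \<open>e > 0\<close> by simp
      then obtain \<eta> where \<eta>: "\<eta> > 0" "\<eta> < 1/8" "turn ` {c - 2 * \<eta>..c + 2 * \<eta>} \<subseteq> A \<inter> ball z e"
        using arc_in_open[of "A \<inter> ball z e" c] A(1) by blast
      have N: "turn t \<in> A \<inter> ball z e" if "t \<in> {c - \<eta>..c + \<eta>}" for t
      proof -
        have "t \<in> {c - 2 * \<eta>..c + 2 * \<eta>}" using \<eta>(1) that by auto
        then show ?thesis using \<eta>(3) by blast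
      qed
      obtain V' where V': "open V'" "turn c \<in> V'" "V' \<inter> circle \<subseteq> turn ` {c - \<eta><..<c + \<eta>}"
        using arc_neighbourhood[OF \<eta>(1)] by blast
      have "V' \<inter> circle \<noteq> {}" using V'(2) turn_in_circle(1) by blast
      then obtain \<epsilon> where \<epsilon>: "\<epsilon> > 0"
        "\<And>z. z \<in> circle \<Longrightarrow> \<exists>w\<in>lists {1..k}. fold f w ` (ball z \<epsilon> \<inter> circle) \<subseteq> V'"
        using uniform_steering[OF V'(1)] by metis
      obtain v where v: "v \<in> lists {1..k}" "fold F v b - fold F v a < \<epsilon> / (2 * pi)"
        using shrinks[of "\<epsilon> / (2 * pi)"] \<epsilon>(1) by auto
      obtain w where w: "w \<in> lists {1..k}" "fold f w ` (ball (turn (fold F v a)) \<epsilon> \<inter> circle) \<subseteq> V'"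
        using \<epsilon>(2)[OF turn_in_circle(1)] by blast
      let ?x = "u @ v @ w"
      have x: "?x \<in> lists {1..k}" using u v w by simp
      have self: "turn (fold F ?x t) \<in> turn ` {c - \<eta><..<c + \<eta>}" if t: "t \<in> {c - \<eta>..c + \<eta>}" for t
      proof -
        have "turn t \<in> A \<inter> circle" using N[OF t] by simp
        then have "fold f u (turn t) \<in> V \<inter> circle"
          using A(2) fold_f_closed[OF u(1) turn_in_circle(1)] by blast
        then obtain s where s: "a < s" "s < b" "fold f u (turn t) = turn s" using V(3) by force
        have "fold F v a < fold F v s" "fold F v s < fold F v b"
          using s circle_lift_strict_mono[OF word_lift[OF v(1)]] by blast+
        then have "\<bar>fold F v s - fold F v a\<bar> < \<epsilon> / (2 * pi)" using v(2) by linarith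
        then have "2 * pi * \<bar>fold F v s - fold F v a\<bar> < \<epsilon>" by (simp add: field_simps)
        then have "dist (turn (fold F v s)) (turn (fold F v a)) < \<epsilon>"
          using dist_turn_le[of "fold F v s" "fold F v a"] by linarith
        then have "turn (fold F v s) \<in> ball (turn (fold F v a)) \<epsilon> \<inter> circle"
          by (simp add: dist_commute)
        then have "fold f w (turn (fold F v s)) \<in> V'" using w(2) by blast
        moreover have "fold f w (turn (fold F v s)) = fold f ?x (turn t)"
          using s(3) by (simp add: word_turn[OF v(1)])
        moreover have "fold f ?x (turn t) = turn (fold F ?x t)" by (rule word_turn[OF x])
        ultimately have "turn (fold F ?x t) \<in> V' \<inter> circle" by simp
        then show ?thesis using V'(3) by blast
      qed
      have "continuous_on UNIV (fold F ?x)" using word_lift[OF x] unfolding circle_lift_def by blast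
      then obtain t where t: "t \<in> {c - \<eta>..c + \<eta>}" "turn (fold F ?x t) = turn t"
        using arc_self_map_fixed_point[of "fold F ?x" \<eta> c] self \<eta>(1,2) by auto
      have "fold f ?x (turn t) = turn t" using word_turn[OF x, of t] t(2) by simp
      moreover have "fold f ?x \<in> IFS k f" unfolding IFS_eq_words using x u(2) by blast
      ultimately have "turn t \<in> IFS_periodic_points circle k f"
        unfolding IFS_periodic_points_def using turn_in_circle(1) by blast
      moreover have "dist (turn t) z < e" using N[OF t(1)] by (simp add: dist_commute)
      ultimately show ?thesis by blast
    qed
    then show "z \<in> closure (IFS_periodic_points circle k f)" by (simp add: closure_approachable)
  qed
qed

lemma fold_concat_replicate: "fold h (concat (replicate n v)) = (fold h v) ^^ n"
  by (induction n) (auto simp: funpow_Suc_right simp del: funpow.simps(2))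

lemma replicate_word: "v \<in> lists {1..k} \<Longrightarrow> concat (replicate n v) \<in> lists {1..k}"
  by (induction n) auto

text \<open>If a power of \<open>h\<close> is the identity, every point is periodic. In all other cases the iterates of
\<open>h\<close> shrink an arc, either because a power has a fixed point and moves some other point, or
because the semiconjugacy to a rotation fails to be injective.\<close>

theorem periodic_points_dense:
  assumes h: "h \<in> IFS k f" and not_conj: "\<not> conjugate_to_rotation h"
  shows "closure (IFS_periodic_points circle k f) = circle"
proof -
  obtain v where v: "h = fold f v" "v \<in> lists {1..k}" "v \<noteq> []" using h unfolding IFS_eq_words by blast
  let ?H = "fold F v"
  have H: "circle_lift ?H" by (rule word_lift[OF v(2)])
  have hH: "h (turn t) = turn (?H t)" for t using word_turn[OF v(2)] v(1) by simp
  have dense: ?thesis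
    if ab: "a < b" and small: "\<And>\<epsilon>. \<epsilon> > 0 \<Longrightarrow> \<exists>n. (?H ^^ n) b - (?H ^^ n) a < \<epsilon>" for a b
  proof (rule periodic_points_dense_if_arc_shrinks[OF ab])
    fix \<epsilon> :: real assume "\<epsilon> > 0"
    then obtain n where "(?H ^^ n) b - (?H ^^ n) a < \<epsilon>" using small by blast
    then show "\<exists>w\<in>lists {1..k}. fold F w b - fold F w a < \<epsilon>"
      by (intro bexI[of _ "concat (replicate n v)"] replicate_word v(2))
        (simp add: fold_concat_replicate)
  qed
  show ?thesis
  proof (cases "\<exists>n t m. n \<ge> 1 \<and> (?H ^^ n) t = t + of_int m")
    case False
    then obtain a b where "shrinks_arc ?H a b"
      using conjugate_or_shrinks_arc[of ?H h, OF H _ hH not_conj] by blast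
    then show ?thesis using dense[of a b] unfolding shrinks_arc_def by blast
  next
    case True
    then obtain n q m where n: "n \<ge> 1" and q: "(?H ^^ n) q = q + of_int m" by blast
    let ?K = "\<lambda>t. (?H ^^ n) t - of_int m"
    have K: "circle_lift ?K" by (rule circle_lift_shift[OF circle_lift_funpow[OF H]])
    show ?thesis
    proof (cases "\<forall>t. ?K t = t")
      case True
      have "z \<in> IFS_periodic_points circle k f" if z: "z \<in> circle" for z
      proof -
        from z obtain t where t: "z = turn t" by (rule circle_turnE)
        let ?w = "concat (replicate n v)"
        have w: "?w \<in> lists {1..k}" by (rule replicate_word[OF v(2)])
        have "?w \<noteq> []" using v(3) n by (cases n) auto
        then have "fold f ?w \<in> IFS k f" using w unfolding IFS_eq_words by blast
        moreover have "fold f ?w z = turn (fold F ?w t)" unfolding t by (rule word_turn[OF w])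
        then have "fold f ?w z = turn ((?H ^^ n) t)" by (simp only: fold_concat_replicate)
        moreover have "(?H ^^ n) t = t + of_int m" using True by (simp add: diff_eq_eq)
        ultimately have "fold f ?w \<in> IFS k f" "fold f ?w z = z" using t by simp_all
        then show ?thesis using z unfolding IFS_periodic_points_def by blast
      qed
      then have "IFS_periodic_points circle k f = circle" by (auto simp: IFS_periodic_points_def)
      then show ?thesis by simp
    next
      case False
      then obtain t where "?K t \<noteq> t" by blast
      then obtain a b where ab: "shrinks_arc ?K a b"
        using fixed_point_shrinks_arc[OF K, of q t] q by auto
      show ?thesis
      proof (rule dense)
        show "a < b" using ab unfolding shrinks_arc_def by blast
        fix \<epsilon> :: real assume "\<epsilon> > 0"
        then obtain j where "(?K ^^ j) b - (?K ^^ j) a < \<epsilon>" using ab unfolding shrinks_arc_def by blast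
        then show "\<exists>n. (?H ^^ n) b - (?H ^^ n) a < \<epsilon>"
          unfolding funpow_shift_lift[OF H] by (intro exI[of _ "n * j"]) simp
      qed
    qed
  qed
qed

end

lemma minimal_circle_IFS_exists_lifts:
  assumes "k \<ge> 1" and homeo: "\<And>i. i \<in> {1..k} \<Longrightarrow> orientation_preserving_homeo (f i)"
    and minimal: "forward_backward_minimal circle k f"
  shows "\<exists>F. minimal_circle_IFS k f F"
proof -
  have "\<exists>G. circle_lift G \<and> (\<forall>t. f i (turn t) = turn (G t))" if "i \<in> {1..k}" for i
    using homeo[OF that] unfolding orientation_preserving_homeo_def circle_lift_def turn_def by blast
  then obtain F where F: "\<And>i. i \<in> {1..k} \<Longrightarrow> circle_lift (F i)"
    "\<And>i t. i \<in> {1..k} \<Longrightarrow> f i (turn t) = turn (F i t)"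
    by metis
  have inverse: "bij_betw (f i) circle circle \<and> continuous_on circle (f i) \<and>
      continuous_on circle (inv_into circle (f i))" if i: "i \<in> {1..k}" for i
  proof -
    obtain g where g: "homeomorphism circle circle (f i) g"
      using homeo[OF i] unfolding orientation_preserving_homeo_def by blast
    have "inj_on (f i) circle" using g unfolding homeomorphism_def by (metis inj_on_inverseI)
    moreover have "f i ` circle = circle" using g unfolding homeomorphism_def by blast
    ultimately have bij: "bij_betw (f i) circle circle" by (simp add: bij_betw_def)
    have "inv_into circle (f i) x = g x" if x: "x \<in> circle" for x
    proof (rule inv_into_f_eq)
      show "inj_on (f i) circle" using bij by (rule bij_betw_imp_inj_on)
      show "g x \<in> circle" using g x unfolding homeomorphism_def by blast
      show "f i (g x) = x" using g x unfolding homeomorphism_def by blast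
    qed
    then have "continuous_on circle (inv_into circle (f i)) \<longleftrightarrow> continuous_on circle g"
      by (intro continuous_on_cong) auto
    then show ?thesis using bij g unfolding homeomorphism_def by blast
  qed
  have "minimal_circle_IFS k f F"
    by unfold_locales (use assms(1) minimal F inverse in \<open>auto simp: forward_backward_minimal_def\<close>)
  then show ?thesis by blast
qed

theorem theorem1:
  fixes k :: nat
    and f :: "nat \<Rightarrow> complex \<Rightarrow> complex"
    and P :: "(nat \<Rightarrow> nat) measure"
  assumes "k \<ge> 1"
    and "\<And>i. i \<in> {1..k} \<Longrightarrow> orientation_preserving_homeo (f i)"
    and "forward_backward_minimal circle k f"
    and "prob_space P"
    and "sets P = sets (restrict_space borel (symbol_seqs k))"
    and "\<exists>p. 0 < p \<and> p \<le> 1 / real k \<and> transition_prob_ge k P p"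
  shows "(\<exists>\<Omega>. \<Omega> \<subseteq> symbol_seqs k \<and> \<Omega> \<in> sets P \<and> measure P \<Omega> = 1 \<and>
            (\<forall>\<omega>\<in>\<Omega>. \<forall>x\<in>circle. closure (fiber_orbit f \<omega> x) = circle) \<and>
            (\<forall>\<omega>\<in>symbol_seqs k. shift_dense_orbit k \<omega> \<longrightarrow> \<omega> \<in> \<Omega>))
       \<and> ((\<exists>h\<in>IFS k f. \<not> conjugate_to_rotation h) \<longrightarrow>
            closure (IFS_periodic_points circle k f) = circle)"
proof -
  obtain F where "minimal_circle_IFS k f F"
    using minimal_circle_IFS_exists_lifts[OF assms(1-3)] by blast
  then interpret minimal_circle_IFS k f F .
  obtain p where p: "0 < p" "p \<le> 1 / real k" "transition_prob_ge k P p" using assms(6) by blast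
  have "1 / real k \<le> 1" using assms(1) by simp
  then have "p \<le> 1" using p(2) by linarith
  interpret process: elliptic_symbol_process P k p
    using assms(4,5) p(1,3) \<open>p \<le> 1\<close>
    by (simp add: elliptic_symbol_process_def elliptic_symbol_process_axioms_def)
  show ?thesis
  proof (intro conjI exI[of _ "disjunctive_seqs k"] ballI impI)
    show "disjunctive_seqs k \<subseteq> symbol_seqs k" by (auto simp: disjunctive_seqs_def)
    show "disjunctive_seqs k \<in> sets P" "measure P (disjunctive_seqs k) = 1"
      using process.disjunctive_almost_surely assms(1) by blast+
    show "closure (fiber_orbit f \<omega> x) = circle" if "\<omega> \<in> disjunctive_seqs k" "x \<in> circle" for \<omega> x
      using dense_fiber_orbit that by blast
    show "\<omega> \<in> disjunctive_seqs k" if "\<omega> \<in> symbol_seqs k" "shift_dense_orbit k \<omega>" for \<omega>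
      using shift_dense_orbit_imp_disjunctive assms(1) that by blast
    show "closure (IFS_periodic_points circle k f) = circle"
      if "\<exists>h\<in>IFS k f. \<not> conjugate_to_rotation h"
      using periodic_points_dense that by blast
  qed
qed

end
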